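(* Suppose Assumptions A1--A5 (listed in the context) hold. Let $\tau(x)=\dfrac{\mu(x,0^+)-\mu(x,0^-)}{p(x,0^+)-p(x,0^-)}$ and $W=Y+(1-D)\tau(X)$. Then the null hypothesis $$\mathbb{H}_0:\ \mathbb{P}\left[\,Y_{1}-Y_{0}=\tau(X)\mid X,\ R=0\,\right]=1\quad\text{a.s.}$$ holds if and only if the conditional distribution of $W$ given $(X,R)$ is continuous at the cutoff, i.e. $$f_{W|XR}(w|x,0^+)=f_{W|XR}(w|x,0^-)\quad\text{for all }(w,x),$$ where $f_{W|XR}(w|x,r)$ denotes the conditional density of $W$ given $X=x,R=r$.
   Context: Model (regression discontinuity with cutoff $R=0$): $Y=g(D,R,X,\epsilon)$, where $Y\in\mathbb{R}$ is the outcome, $D\in\{0,1\}$ a binary treatment, $R\in\mathbb{R}$ the running variable, $X\in\mathcal{X}\subset\mathbb{R}^d$ covariates, $\epsilon\in\mathbb{R}^{d_\epsilon}$ an unobserved disturbance, and $g$ is measurable. Potential outcomes: $Y_1=g(1,R,X,\epsilon)$, $Y_0=g(0,R,X,\epsilon)$, so $Y=DY_1+(1-D)Y_0$. Put $p(x,r)=\mathbb{P}(D=1|X=x,R=r)$ and $\mu(x,r)=\mathbb{E}[Y|X=x,R=r]$. For any function $\psi(x,r)$, $\psi(x,0^-)=\lim_{r\uparrow0}\psi(x,r)$ and $\psi(x,0^+)=\lim_{r\downarrow0}\psi(x,r)$ (similarly for $f_{W|XR}(w|x,r)$). $\mathcal{S}$ with a subscript denotes the (conditional) support of the indicated variables.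 Assumption A1. The conditional density $f_{R|X}(r|x)$ is continuous at $r=0$ uniformly in $x\in\mathcal{X}$ and strictly positive in a neighborhood of $r=0$. Assumption A2. $\mathbb{P}(R\ge0\mid X=x)$ is bounded away from zero and one for all $x\in\mathcal{X}$. Assumption A3. $D=\mathbf{1}(\theta(X,R)\ge\eta)$ with an unknown function $\theta$ that is continuous in $r$ on each side of the cutoff and satisfies $\theta(x,0^+)>\theta(x,0^-)$ for all $x\in\mathcal{X}$. The latent variable $\eta$ satisfies $(\eta,\epsilon)\perp R\mid X$, and the conditional CDF $F_{\eta|X}(\cdot|x)$ is strictly increasing for each $x\in\mathcal{X}$. The set of compliers is $\mathcal{C}_x=\{\eta\in\mathbb{R}:\theta(x,0^-)<\eta\le\theta(x,0^+)\}$. Assumption A4. $g(d,r,x,\epsilon)$ is continuous in $r$ in a neighborhood of $r=0$ for all $d,x,\epsilon$. There exist a measurable function $\tilde g:\mathcal{S}_{DX}\times\mathbb{R}\to\mathbb{R}$ and a scalar-valued function $\nu:\mathcal{S}_{X\epsilon}\to\mathbb{R}$ such that $g(D,0,X,\epsilon)=\tilde g(D,X,\nu(X,\epsilon))$, where $\tilde g$ is strictly increasing in $\nu$. Assumption A5. For each $d\in\{0,1\}$ and $x\in\mathcal{X}$, $\mathcal{S}_{g(d,0,x,\epsilon)|X=x,\eta\in\mathcal{C}_x}=\mathcal{S}_{g(d,0,x,\epsilon)|X=x}$.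
   Formalization: Added: the conditional CDF of η given X is continuous at θ(x,0⁻) and θ(x,0⁺); the one-sided limits of f_{W|XR} exist and integrate to one. Density equality is for almost every x and almost every w (every w if both limits are continuous in w); the literal claim fails otherwise. *)

theory Defs
  imports "HOL-Probability.Probability"
begin

definition has_left_lim :: "(real \<Rightarrow> real) \<Rightarrow> bool" where
  "has_left_lim f \<longleftrightarrow> (\<exists>l. (f \<longlongrightarrow> l) (at_left 0))"

definition has_right_lim :: "(real \<Rightarrow> real) \<Rightarrow> bool" where
  "has_right_lim f \<longleftrightarrow> (\<exists>l. (f \<longlongrightarrow> l) (at_right 0))"

text \<open>Unspecified where the limit does not exist, so always used together with the predicates above.\<close>

definition left_lim :: "(real \<Rightarrow> real) \<Rightarrow> real" where
  "left_lim f = Lim (at_left 0) f"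

definition right_lim :: "(real \<Rightarrow> real) \<Rightarrow> real" where
  "right_lim f = Lim (at_right 0) f"

definition msupport :: "'b::topological_space measure \<Rightarrow> 'b set" where
  "msupport N = {y. \<forall>U. open U \<and> y \<in> U \<longrightarrow> 0 < emeasure N U}"

text \<open>\<open>K v\<close> is a version of the law of \<open>Z\<close> given \<open>V = v\<close>.\<close>

definition regular_cond_distr ::
  "'a measure \<Rightarrow> 'v measure \<Rightarrow> ('a \<Rightarrow> 'v) \<Rightarrow> 'z measure \<Rightarrow> ('a \<Rightarrow> 'z) \<Rightarrow> ('v \<Rightarrow> 'z measure) \<Rightarrow> bool"
where
  "regular_cond_distr M N V S Z K \<longleftrightarrow>
     V \<in> measurable M N \<and> Z \<in> measurable M S \<and> K \<in> measurable N (prob_algebra S) \<and>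
     (\<forall>A\<in>sets N. \<forall>B\<in>sets S.
        emeasure M (V -` A \<inter> Z -` B \<inter> space M) =
        (\<integral>\<^sup>+v. emeasure (K v) B * indicator A v \<partial>distr M N V))"

text \<open>\<open>f v\<close> is a version of the Lebesgue density of the law of \<open>Z\<close> given \<open>V = v\<close>.\<close>

definition cond_density ::
  "'a measure \<Rightarrow> 'v measure \<Rightarrow> ('a \<Rightarrow> 'v) \<Rightarrow> ('a \<Rightarrow> real) \<Rightarrow> ('v \<Rightarrow> real \<Rightarrow> real) \<Rightarrow> bool"
where
  "cond_density M N V Z f \<longleftrightarrow>
     (\<lambda>(v, z). f v z) \<in> borel_measurable (N \<Otimes>\<^sub>M lborel) \<and> (\<forall>v z. 0 \<le> f v z) \<and>
     regular_cond_distr M N V borel Z (\<lambda>v. density lborel (\<lambda>z. ennreal (f v z)))"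

text \<open>\<open>m v\<close> is a version of the expectation of \<open>Z\<close> given \<open>V = v\<close>.\<close>

definition cond_mean ::
  "'a measure \<Rightarrow> 'v measure \<Rightarrow> ('a \<Rightarrow> 'v) \<Rightarrow> ('a \<Rightarrow> real) \<Rightarrow> ('v \<Rightarrow> real) \<Rightarrow> bool"
where
  "cond_mean M N V Z m \<longleftrightarrow>
     V \<in> measurable M N \<and> integrable M Z \<and> m \<in> borel_measurable N \<and>
     (AE \<omega> in M. real_cond_exp M (vimage_algebra (space M) V N) Z \<omega> = m (V \<omega>))"

text \<open>Conditional independence of \<open>U\<close> and \<open>V\<close> given the sub-sigma-algebra \<open>F\<close>.\<close>

definition cond_indep ::
  "'a measure \<Rightarrow> 'a measure \<Rightarrow> 'u measure \<Rightarrow> ('a \<Rightarrow> 'u) \<Rightarrow> 'v measure \<Rightarrow> ('a \<Rightarrow> 'v) \<Rightarrow> bool"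
where
  "cond_indep M F S U T V \<longleftrightarrow>
     (\<forall>B\<in>sets S. \<forall>C\<in>sets T. AE \<omega> in M.
        real_cond_exp M F (indicator (U -` B \<inter> V -` C \<inter> space M)) \<omega> =
        real_cond_exp M F (indicator (U -` B \<inter> space M)) \<omega> *
        real_cond_exp M F (indicator (V -` C \<inter> space M)) \<omega>)"

definition compliers :: "('x \<Rightarrow> real \<Rightarrow> real) \<Rightarrow> 'x \<Rightarrow> real set" where
  "compliers theta x = {left_lim (theta x) <.. right_lim (theta x)}"

text \<open>
  \<open>K x\<close> is the law of \<open>(\<eta>, \<epsilon>)\<close> given \<open>X = x\<close>. The event \<open>R = 0\<close> has probability zero; because
  \<open>(\<eta>, \<epsilon>)\<close> is independent of \<open>R\<close> given \<open>X\<close>, \<open>K x\<close> is also taken as the law of \<open>(\<eta>, \<epsilon>)\<close> given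
  \<open>X = x, R = 0\<close>, and on that event the potential outcomes are \<open>g d 0 x \<epsilon>\<close>.
\<close>

definition homogeneous_effect_at_cutoff ::
  "'x measure \<Rightarrow> ('x \<Rightarrow> (real \<times> 'e) measure) \<Rightarrow> (real \<Rightarrow> real \<Rightarrow> 'x \<Rightarrow> 'e \<Rightarrow> real) \<Rightarrow> ('x \<Rightarrow> real) \<Rightarrow> bool"
where
  "homogeneous_effect_at_cutoff PX K g tau \<longleftrightarrow>
     (AE x in PX. \<P>(z in K x. g 1 0 x (snd z) - g 0 0 x (snd z) = tau x) = 1)"

end

theory Submission
  imports Defs
begin

text \<open>
  Conditional independence makes \<open>K x\<close> the law of \<open>(\<eta>, \<epsilon>)\<close> given \<open>X = x, R = r\<close> as well, so for almost
  every \<open>x\<close> the density \<open>fW (x, r)\<close> is, for almost every \<open>r\<close> near \<open>0\<close>, that of the image of \<open>K x\<close> under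
  \<open>g 1 r x \<epsilon>\<close> on \<open>{\<eta> \<le> \<theta> x r}\<close> and \<open>g 0 r x \<epsilon> + \<tau> x\<close> elsewhere. Letting \<open>r\<close> tend to \<open>0\<close> from one side,
  Scheffe's lemma identifies the limiting density with the law of the limiting variable, which switches
  from \<open>A = g 1 0 x \<epsilon>\<close> to \<open>B = g 0 0 x \<epsilon> + \<tau> x\<close> at the corresponding one-sided limit of \<open>\<theta> x\<close>. The two
  limiting laws differ only through the compliers, hence agree iff \<open>A\<close> and \<open>B\<close> have the same law
  on the compliers.

  Since \<open>A\<close> and \<open>B\<close> are increasing functions of the same scalar \<open>\<nu>\<close>, equality in law forces \<open>A = B\<close> almost
  surely on the compliers. Off the compliers, \<open>A < B\<close> can only happen across a gap of the common
  support, with \<open>A\<close> and \<open>B\<close> its two end points. There are countably many gaps, and \<open>A\<close> has no atoms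
  where \<open>\<eta>\<close> is below the upper limit of \<open>\<theta> x\<close>, nor has \<open>B\<close> where \<open>\<eta>\<close> is above it, because the
  limiting laws have densities; so this event is null.
\<close>

subsection \<open>Regular conditional distributions\<close>

text \<open>Rectangles form an intersection-stable generator that contains the whole space, so
  finiteness of \<open>P\<close> alone supplies the exhaustion required for uniqueness of
  measures.\<close>

lemma finite_measure_eqI_rectangles:
  assumes "finite_measure P" and sets: "sets P = sets (N \<Otimes>\<^sub>M S)" "sets Q = sets (N \<Otimes>\<^sub>M S)"
    and eq: "\<And>A B. A \<in> sets N \<Longrightarrow> B \<in> sets S \<Longrightarrow> emeasure P (A \<times> B) = emeasure Q (A \<times> B)"
  shows "P = Q"
proof (rule measure_eqI_generator_eq[OF Int_stable_pair_measure_generator])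
  interpret finite_measure P by fact
  show "{a \<times> b |a b. a \<in> sets N \<and> b \<in> sets S} \<subseteq> Pow (space N \<times> space S)"
    using sets.space_closed[of N] sets.space_closed[of S] by auto
  show "range (\<lambda>_::nat. space N \<times> space S) \<subseteq> {a \<times> b |a b. a \<in> sets N \<and> b \<in> sets S}" by auto
  show "emeasure P (space N \<times> space S) \<noteq> \<infinity>" by simp
qed (auto simp: sets sets_pair_measure eq)

lemma rcd_measurable:
  assumes "regular_cond_distr M N V S Z K"
  shows "V \<in> measurable M N" "Z \<in> measurable M S" "K \<in> measurable N (prob_algebra S)"
  using assms by (auto simp: regular_cond_distr_def)

lemma rcd_kernel:
  assumes "regular_cond_distr M N V S Z K" "v \<in> space N"
  shows "prob_space (K v)" "sets (K v) = sets S" "space (K v) = space S"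
proof -
  have "K v \<in> space (prob_algebra S)"
    using assms by (auto simp: regular_cond_distr_def dest: measurable_space)
  then show "prob_space (K v)" "sets (K v) = sets S"
    by (auto simp: space_prob_algebra)
  then show "space (K v) = space S" by (intro sets_eq_imp_space_eq)
qed

text \<open>Disintegration of the joint law: the defining identity of a kernel is this equality
  tested on rectangles.\<close>

lemma rcd_distr_pair:
  assumes "prob_space M" and K: "regular_cond_distr M N V S Z K"
  shows "distr M (N \<Otimes>\<^sub>M S) (\<lambda>\<omega>. (V \<omega>, Z \<omega>)) =
    distr M N V \<bind> (\<lambda>v. distr (K v) (N \<Otimes>\<^sub>M S) (Pair v))"
proof (rule finite_measure_eqI_rectangles[where N=N and S=S])
  interpret prob_space M by fact
  note [measurable] = rcd_measurable[OF K]
  have V: "distr M N V \<in> space (prob_algebra N)"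
    by (simp add: space_prob_algebra prob_space_distr)
  have [measurable]: "(\<lambda>v. distr (K v) (N \<Otimes>\<^sub>M S) (Pair v)) \<in> N \<rightarrow>\<^sub>M prob_algebra (N \<Otimes>\<^sub>M S)"
    by measurable
  show "finite_measure (distr M (N \<Otimes>\<^sub>M S) (\<lambda>\<omega>. (V \<omega>, Z \<omega>)))"
    by (intro finite_measure_distr) measurable
  show "sets (distr M N V \<bind> (\<lambda>v. distr (K v) (N \<Otimes>\<^sub>M S) (Pair v))) = sets (N \<Otimes>\<^sub>M S)"
    using not_empty measurable_space[OF rcd_measurable(1)[OF K]]
    by (intro sets_bind) auto
  fix A B assume [measurable]: "A \<in> sets N" "B \<in> sets S"
  have "emeasure (distr M (N \<Otimes>\<^sub>M S) (\<lambda>\<omega>. (V \<omega>, Z \<omega>))) (A \<times> B) =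
      emeasure M (V -` A \<inter> Z -` B \<inter> space M)"
    by (subst emeasure_distr) (auto intro!: arg_cong2[where f=emeasure])
  also have "\<dots> = (\<integral>\<^sup>+v. emeasure (K v) B * indicator A v \<partial>distr M N V)"
    using K by (auto simp: regular_cond_distr_def)
  also have "\<dots> = (\<integral>\<^sup>+v. emeasure (distr (K v) (N \<Otimes>\<^sub>M S) (Pair v)) (A \<times> B) \<partial>distr M N V)"
  proof (intro nn_integral_cong)
    fix v assume "v \<in> space (distr M N V)"
    then have v: "v \<in> space N" by simp
    note [measurable_cong] = rcd_kernel(2)[OF K v]
    show "emeasure (K v) B * indicator A v = emeasure (distr (K v) (N \<Otimes>\<^sub>M S) (Pair v)) (A \<times> B)"
      using v sets.sets_into_space[OF \<open>B \<in> sets S\<close>] rcd_kernel(3)[OF K v]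
      by (subst emeasure_distr)
        (auto split: split_indicator intro!: arg_cong2[where f=emeasure])
  qed
  also have "\<dots> = emeasure (distr M N V \<bind> (\<lambda>v. distr (K v) (N \<Otimes>\<^sub>M S) (Pair v))) (A \<times> B)"
    by (rule emeasure_bind_prob_algebra[OF V, symmetric]) measurable
  finally show "emeasure (distr M (N \<Otimes>\<^sub>M S) (\<lambda>\<omega>. (V \<omega>, Z \<omega>))) (A \<times> B) =
    emeasure (distr M N V \<bind> (\<lambda>v. distr (K v) (N \<Otimes>\<^sub>M S) (Pair v))) (A \<times> B)" .
qed simp

text \<open>The form of the disintegration on which the arguments about null sets, images and
  conditional independence rest.\<close>

lemma rcd_nn_integral:
  assumes M: "prob_space M" and K: "regular_cond_distr M N V S Z K"
    and u [measurable]: "u \<in> borel_measurable (N \<Otimes>\<^sub>M S)"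
  shows "(\<integral>\<^sup>+\<omega>. u (V \<omega>, Z \<omega>) \<partial>M) = (\<integral>\<^sup>+v. \<integral>\<^sup>+z. u (v, z) \<partial>K v \<partial>distr M N V)"
proof -
  note [measurable] = rcd_measurable[OF K]
  have "(\<integral>\<^sup>+\<omega>. u (V \<omega>, Z \<omega>) \<partial>M) =
      (\<integral>\<^sup>+y. u y \<partial>(distr M N V \<bind> (\<lambda>v. distr (K v) (N \<Otimes>\<^sub>M S) (Pair v))))"
    unfolding rcd_distr_pair[OF M K, symmetric] by (subst nn_integral_distr) auto
  also have "\<dots> = (\<integral>\<^sup>+v. \<integral>\<^sup>+y. u y \<partial>distr (K v) (N \<Otimes>\<^sub>M S) (Pair v) \<partial>distr M N V)"
    by (rule nn_integral_bind[OF u]) (simp, intro measurable_prob_algebraD, measurable)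
  also have "\<dots> = (\<integral>\<^sup>+v. \<integral>\<^sup>+z. u (v, z) \<partial>K v \<partial>distr M N V)"
  proof (intro nn_integral_cong)
    fix v assume "v \<in> space (distr M N V)"
    then have v: "v \<in> space N" by simp
    note [measurable_cong] = rcd_kernel(2)[OF K v]
    show "(\<integral>\<^sup>+y. u y \<partial>distr (K v) (N \<Otimes>\<^sub>M S) (Pair v)) = (\<integral>\<^sup>+z. u (v, z) \<partial>K v)"
      using v by (subst nn_integral_distr) auto
  qed
  finally show ?thesis .
qed

text \<open>The iterated integral of the indicator of the exceptional set is the probability of that
  set, which is zero, so the inner integral vanishes for almost every \<open>v\<close>.\<close>

lemma rcd_AE:
  assumes M: "prob_space M" and K: "regular_cond_distr M N V S Z K"
    and P [measurable]: "Measurable.pred (N \<Otimes>\<^sub>M S) P"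
    and ae: "AE \<omega> in M. P (V \<omega>, Z \<omega>)"
  shows "AE v in distr M N V. AE z in K v. P (v, z)"
proof -
  note [measurable] = rcd_measurable[OF K] 
  note [measurable] = measurable_prob_algebraD[OF rcd_measurable(3)[OF K]]
  let ?u = "\<lambda>y. indicator {y \<in> space (N \<Otimes>\<^sub>M S). \<not> P y} y :: ennreal"
  have "(\<integral>\<^sup>+v. \<integral>\<^sup>+z. ?u (v, z) \<partial>K v \<partial>distr M N V) = (\<integral>\<^sup>+\<omega>. ?u (V \<omega>, Z \<omega>) \<partial>M)"
    by (rule rcd_nn_integral[OF M K, symmetric]) measurable
  also have "\<dots> = (\<integral>\<^sup>+\<omega>. 0 \<partial>M)"
    using ae by (intro nn_integral_cong_AE) auto
  finally have "(\<integral>\<^sup>+v. \<integral>\<^sup>+z. ?u (v, z) \<partial>K v \<partial>distr M N V) = 0" by simp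
  then have "AE v in distr M N V. (\<integral>\<^sup>+z. ?u (v, z) \<partial>K v) = 0"
    by (subst (asm) nn_integral_0_iff_AE)
       (auto intro!: nn_integral_measurable_subprob_algebra2[where N=S])
  moreover have "AE v in distr M N V. v \<in> space N" using AE_space[of "distr M N V"] by simp
  ultimately show ?thesis
  proof eventually_elim
    fix v assume v: "v \<in> space N" and 0: "(\<integral>\<^sup>+z. ?u (v, z) \<partial>K v) = 0"
    have "Pair v \<in> K v \<rightarrow>\<^sub>M N \<Otimes>\<^sub>M S"
      using v by (simp cong: measurable_cong_sets add: rcd_kernel(2)[OF K v])
    then have "(\<lambda>z. ?u (v, z)) \<in> borel_measurable (K v)" by (rule measurable_compose) measurable
    with 0 have "AE z in K v. ?u (v, z) = 0" by (simp add: nn_integral_0_iff_AE)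
    moreover have "AE z in K v. z \<in> space S" using AE_space[of "K v"] rcd_kernel(3)[OF K v] by simp
    ultimately show "AE z in K v. P (v, z)"
      by eventually_elim (use v in \<open>auto simp: space_pair_measure split: split_indicator_asm\<close>)
  qed
qed

text \<open>Meant for properties without evident measurability, such as an equality of measures or
  an almost-everywhere statement under a kernel. The failures are covered by a measurable null set,
  to which \<open>rcd_AE\<close> applies.\<close>

lemma rcd_AE_distr:
  assumes M: "prob_space M" and K: "regular_cond_distr M N V S Z K"
    and ae: "AE y in distr M (N \<Otimes>\<^sub>M S) (\<lambda>\<omega>. (V \<omega>, Z \<omega>)). P y"
  shows "AE v in distr M N V. AE z in K v. P (v, z)"
proof -
  note [measurable] = rcd_measurable[OF K]
  let ?D = "distr M (N \<Otimes>\<^sub>M S) (\<lambda>\<omega>. (V \<omega>, Z \<omega>))"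
  obtain G where G: "{y\<in>space ?D. \<not> P y} \<subseteq> G" and G0: "emeasure ?D G = 0" and "G \<in> sets ?D"
    using ae by (rule AE_E)
  then have [measurable]: "G \<in> sets (N \<Otimes>\<^sub>M S)" by simp
  have "AE y in ?D. y \<notin> G" using G0 by (intro AE_not_in) auto
  then have "AE \<omega> in M. (V \<omega>, Z \<omega>) \<notin> G" by (rule AE_distrD[rotated]) measurable
  then have "AE v in distr M N V. AE z in K v. (v, z) \<notin> G"
    by (intro rcd_AE[OF M K]) measurable
  moreover have "AE v in distr M N V. v \<in> space N" using AE_space[of "distr M N V"] by simp
  ultimately show ?thesis
  proof eventually_elim
    fix v assume v: "v \<in> space N" and vG: "AE z in K v. (v, z) \<notin> G"
    from vG AE_space[of "K v"] show "AE z in K v. P (v, z)"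
      by eventually_elim (use v G rcd_kernel(3)[OF K v] in \<open>auto simp: space_pair_measure\<close>)
  qed
qed

lemma rcd_cong:
  assumes "regular_cond_distr M N V S Z K" and "\<And>\<omega>. \<omega> \<in> space M \<Longrightarrow> Z \<omega> = Z' \<omega>"
  shows "regular_cond_distr M N V S Z' K"
proof -
  have "V -` A \<inter> Z -` B \<inter> space M = V -` A \<inter> Z' -` B \<inter> space M" for A B
    using assms(2) by auto
  with assms show ?thesis
    by (simp add: regular_cond_distr_def cong: measurable_cong)
qed

text \<open>Conditioning freezes the first argument of \<open>f\<close>. This yields the law of
  \<open>W\<close> from that of \<open>(\<eta>, \<epsilon>)\<close> with \<open>X\<close> and
  \<open>R\<close> held at their conditioning values.\<close>

lemma rcd_distr:
  assumes M: "prob_space M" and K: "regular_cond_distr M N V S Z K"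
    and f [measurable]: "f \<in> measurable (N \<Otimes>\<^sub>M S) T"
  shows "regular_cond_distr M N V T (\<lambda>\<omega>. f (V \<omega>, Z \<omega>)) (\<lambda>v. distr (K v) T (\<lambda>z. f (v, z)))"
  unfolding regular_cond_distr_def
proof (intro conjI ballI)
  note [measurable] = rcd_measurable[OF K]
  show "V \<in> measurable M N" "(\<lambda>\<omega>. f (V \<omega>, Z \<omega>)) \<in> measurable M T"
    "(\<lambda>v. distr (K v) T (\<lambda>z. f (v, z))) \<in> N \<rightarrow>\<^sub>M prob_algebra T"
    by measurable
  fix A B assume [measurable]: "A \<in> sets N" "B \<in> sets T"
  let ?u = "\<lambda>y. indicator A (fst y) * indicator B (f y) :: ennreal"
  have "emeasure M (V -` A \<inter> (\<lambda>\<omega>. f (V \<omega>, Z \<omega>)) -` B \<inter> space M) =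
      (\<integral>\<^sup>+\<omega>. indicator (V -` A \<inter> (\<lambda>\<omega>. f (V \<omega>, Z \<omega>)) -` B \<inter> space M) \<omega> \<partial>M)"
    by (subst nn_integral_indicator) auto
  also have "\<dots> = (\<integral>\<^sup>+\<omega>. ?u (V \<omega>, Z \<omega>) \<partial>M)"
    by (intro nn_integral_cong) (auto split: split_indicator)
  also have "\<dots> = (\<integral>\<^sup>+v. \<integral>\<^sup>+z. ?u (v, z) \<partial>K v \<partial>distr M N V)"
    by (rule rcd_nn_integral[OF M K]) measurable
  also have "\<dots> = (\<integral>\<^sup>+v. emeasure (distr (K v) T (\<lambda>z. f (v, z))) B * indicator A v \<partial>distr M N V)"
  proof (intro nn_integral_cong)
    fix v assume "v \<in> space (distr M N V)"
    then have v: "v \<in> space N" by simp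
    note [measurable_cong] = rcd_kernel(2)[OF K v]
    have [measurable]: "(\<lambda>z. f (v, z)) \<in> measurable (K v) T" using v by measurable
    have "(\<integral>\<^sup>+z. ?u (v, z) \<partial>K v) = indicator A v * (\<integral>\<^sup>+z. indicator B (f (v, z)) \<partial>K v)"
      by (simp add: nn_integral_cmult)
    also have "(\<integral>\<^sup>+z. indicator B (f (v, z)) \<partial>K v) = (\<integral>\<^sup>+z. indicator B z \<partial>distr (K v) T (\<lambda>z. f (v, z)))"
      by (subst nn_integral_distr) auto
    finally show "(\<integral>\<^sup>+z. ?u (v, z) \<partial>K v) = emeasure (distr (K v) T (\<lambda>z. f (v, z))) B * indicator A v"
      by (simp add: mult.commute)
  qed
  finally show "emeasure M (V -` A \<inter> (\<lambda>\<omega>. f (V \<omega>, Z \<omega>)) -` B \<inter> space M) = \<dots>" .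
qed

text \<open>For each rational \<open>q\<close>, the mass that a version gives to the half-line up to
  \<open>q\<close> is a density, with respect to the law of \<open>V\<close>, of one and the same
  measure. Hence two versions agree at all rationals outside a single null set, and right-continuity
  of the cdf does the rest.\<close>

lemma rcd_unique:
  fixes Z :: "'a \<Rightarrow> real"
  assumes M: "prob_space M"
    and K: "regular_cond_distr M N V borel Z K" and L: "regular_cond_distr M N V borel Z L"
  shows "AE v in distr M N V. K v = L v"
proof -
  interpret M: prob_space M by fact
  interpret V: prob_space "distr M N V" by (rule M.prob_space_distr[OF rcd_measurable(1)[OF K]])
  note [measurable] = measurable_prob_algebraD[OF rcd_measurable(3)[OF K]]
    measurable_prob_algebraD[OF rcd_measurable(3)[OF L]]
  have "AE v in distr M N V. emeasure (K v) {..real_of_rat q} = emeasure (L v) {..real_of_rat q}" for q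
  proof (rule V.density_unique_finite_measure)
    show "(\<integral>\<^sup>+v. emeasure (K v) {..real_of_rat q} * indicator A v \<partial>distr M N V) =
        (\<integral>\<^sup>+v. emeasure (L v) {..real_of_rat q} * indicator A v \<partial>distr M N V)"
      if "A \<in> sets (distr M N V)" for A
      using K L that by (auto simp: regular_cond_distr_def)
  qed (auto intro!: measurable_emeasure_kernel)
  then have "AE v in distr M N V. \<forall>q. emeasure (K v) {..real_of_rat q} = emeasure (L v) {..real_of_rat q}"
    by (simp add: AE_all_countable)
  moreover have "AE v in distr M N V. v \<in> space N" using AE_space[of "distr M N V"] by simp
  ultimately show ?thesis
  proof eventually_elim
    fix v assume v: "v \<in> space N"
      and q: "\<forall>q. emeasure (K v) {..real_of_rat q} = emeasure (L v) {..real_of_rat q}"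
    interpret K: real_distribution "K v"
      using rcd_kernel[OF K v] by (auto simp: real_distribution_def real_distribution_axioms_def)
    interpret L: real_distribution "L v"
      using rcd_kernel[OF L v] by (auto simp: real_distribution_def real_distribution_axioms_def)
    show "K v = L v"
    proof (rule cdf_unique)
      show "cdf (K v) = cdf (L v)"
      proof
        fix a
        have "(cdf (K v) \<longlongrightarrow> cdf (K v) a) (at_right a)" "(cdf (L v) \<longlongrightarrow> cdf (L v) a) (at_right a)"
          using K.cdf_is_right_cont[of a] L.cdf_is_right_cont[of a] by (auto simp: continuous_within)
        moreover have "\<exists>s. (\<forall>n. s n > a \<and> s n \<in> \<rat>) \<and> s \<longlonglongrightarrow> a"
        proof -
          have "\<exists>r\<in>\<rat>. a < r \<and> r < a + 1 / Suc n" for n by (rule Rats_dense_in_real) simp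
          then obtain s where s: "\<And>n. s n \<in> \<rat> \<and> a < s n \<and> s n < a + 1 / Suc n" by metis
          have "s \<longlonglongrightarrow> a"
          proof (rule tendsto_sandwich[of "\<lambda>_. a" s _ "\<lambda>n. a + 1 / Suc n"])
            show "(\<lambda>n. a + 1 / Suc n) \<longlonglongrightarrow> a"
              using tendsto_add[OF tendsto_const LIMSEQ_inverse_real_of_nat, of a] by (simp add: inverse_eq_divide)
          qed (use s in \<open>auto intro!: always_eventually less_imp_le\<close>)
          with s show ?thesis by blast
        qed
        then obtain s where s: "\<And>n. s n > a" "\<And>n. s n \<in> \<rat>" "s \<longlonglongrightarrow> a" by blast
        then have "filterlim s (at_right a) sequentially"
          by (auto simp: filterlim_at intro: always_eventually)
        ultimately have "(\<lambda>n. cdf (K v) (s n)) \<longlonglongrightarrow> cdf (K v) a" "(\<lambda>n. cdf (L v) (s n)) \<longlonglongrightarrow> cdf (L v) a"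
          by (auto intro: filterlim_compose)
        moreover have "cdf (K v) (s n) = cdf (L v) (s n)" for n
          using s(2)[of n] q by (auto simp: cdf_def measure_def elim!: Rats_cases)
        ultimately show "cdf (K v) a = cdf (L v) a" by (simp add: LIMSEQ_unique)
      qed
    qed unfold_locales
  qed
qed

text \<open>Translates kernels into conditional expectations given the sigma-algebra generated by
  \<open>V\<close>, the language in which \<open>cond_indep\<close> is phrased.\<close>

lemma rcd_cond_exp:
  assumes M: "prob_space M" and K: "regular_cond_distr M N V S Z K"
    and B [measurable]: "B \<in> sets S"
  shows "AE \<omega> in M. real_cond_exp M (vimage_algebra (space M) V N) (indicator (Z -` B \<inter> space M)) \<omega> =
    measure (K (V \<omega>)) B"
proof -
  interpret prob_space M by fact
  note [measurable] = rcd_measurable[OF K]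
  note [measurable] = measurable_prob_algebraD[OF rcd_measurable(3)[OF K]]
  let ?F = "vimage_algebra (space M) V N"
  have sub: "subalgebra M ?F"
    unfolding subalgebra_def
    by (intro conjI sets_image_in_sets) (auto intro: rcd_measurable[OF K])
  interpret F: sigma_finite_subalgebra M ?F
    by (intro finite_measure_subalgebra_is_sigma_finite finite_measure_subalgebra.intro
        finite_measure_subalgebra_axioms.intro sub) unfold_locales
  have VF [measurable]: "V \<in> ?F \<rightarrow>\<^sub>M N"
    using measurable_space[OF rcd_measurable(1)[OF K]] by (intro measurable_vimage_algebra1) auto
  have KB [measurable]: "(\<lambda>v. measure (K v) B) \<in> borel_measurable N" by measurable
  have b: "0 \<le> measure (K v) B \<and> measure (K v) B \<le> 1" if "v \<in> space N" for v
    using prob_space.prob_le_1[OF rcd_kernel(1)[OF K that]] by auto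
  have bV: "measure (K (V \<omega>)) B \<le> 1" if "\<omega> \<in> space M" for \<omega>
    using b measurable_space[OF rcd_measurable(1)[OF K] that] by blast
  show ?thesis
  proof (rule F.real_cond_exp_charact)
    \<comment> \<open>Every set of \<open>?F\<close> is a preimage under \<open>V\<close>, so the
      test integral over it reduces to the defining identity of \<open>K\<close>.\<close>
    fix A' assume "A' \<in> sets ?F"
    then obtain A where A [measurable]: "A \<in> sets N" and A': "A' = V -` A \<inter> space M"
      using measurable_space[OF rcd_measurable(1)[OF K]] by (auto simp: sets_vimage_algebra2)
    have "ennreal (\<integral>\<omega>\<in>A'. indicator (Z -` B \<inter> space M) \<omega> \<partial>M) = emeasure M (V -` A \<inter> Z -` B \<inter> space M)"
      unfolding set_lebesgue_integral_def A' emeasure_eq_measure real_scaleR_def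
      by (subst indicator_inter_arith[symmetric]) (auto intro!: arg_cong[where f="measure M"])
    also have "\<dots> = (\<integral>\<^sup>+v. emeasure (K v) B * indicator A v \<partial>distr M N V)"
      using K by (auto simp: regular_cond_distr_def)
    also have "\<dots> = (\<integral>\<^sup>+\<omega>. emeasure (K (V \<omega>)) B * indicator A (V \<omega>) \<partial>M)"
      by (subst nn_integral_distr) auto
    also have "\<dots> = (\<integral>\<^sup>+\<omega>. ennreal (indicator A' \<omega> * measure (K (V \<omega>)) B) \<partial>M)"
    proof (intro nn_integral_cong)
      fix \<omega> assume "\<omega> \<in> space M"
      then have "V \<omega> \<in> space N" by (rule measurable_space[OF rcd_measurable(1)[OF K]])
      then interpret K: prob_space "K (V \<omega>)" by (rule rcd_kernel[OF K])
      show "emeasure (K (V \<omega>)) B * indicator A (V \<omega>) = ennreal (indicator A' \<omega> * measure (K (V \<omega>)) B)"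
        using \<open>\<omega> \<in> space M\<close> by (auto simp: A' K.emeasure_eq_measure split: split_indicator)
    qed
    also have "\<dots> = ennreal (\<integral>\<omega>\<in>A'. measure (K (V \<omega>)) B \<partial>M)"
      unfolding set_lebesgue_integral_def A'
      by (subst nn_integral_eq_integral)
         (auto intro!: integrable_const_bound[where B=1] AE_I2 bV split: split_indicator)
    finally show "(\<integral>\<omega>\<in>A'. indicator (Z -` B \<inter> space M) \<omega> \<partial>M) = (\<integral>\<omega>\<in>A'. measure (K (V \<omega>)) B \<partial>M)"
      by (subst (asm) ennreal_inj) (auto simp: set_lebesgue_integral_def intro!: integral_nonneg_AE)
  next
    show "integrable M (\<lambda>\<omega>. measure (K (V \<omega>)) B)"
      by (auto intro!: integrable_const_bound[where B=1] AE_I2 bV)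
  qed (auto intro!: integrable_real_indicator simp: emeasure_eq_measure)
qed

text \<open>Given \<open>V\<close>, events about \<open>Z\<close> and \<open>U\<close> factorize, so
  the probability of a rectangle is a mean of the product of the two kernels. Undoing the
  conditioning in the factor of \<open>U\<close> alone leaves the kernel of \<open>Z\<close>
  integrated over an event about \<open>(V, U)\<close>.\<close>

lemma rcd_cond_indep:
  assumes M: "prob_space M" and K: "regular_cond_distr M N V S Z K"
    and L: "regular_cond_distr M N V T U L"
    and ind: "cond_indep M (vimage_algebra (space M) V N) S Z T U"
  shows "regular_cond_distr M (N \<Otimes>\<^sub>M T) (\<lambda>\<omega>. (V \<omega>, U \<omega>)) S Z (\<lambda>v. K (fst v))"
proof -
  interpret prob_space M by fact
  note [measurable] = rcd_measurable[OF K] rcd_measurable[OF L]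
  note [measurable] = measurable_prob_algebraD[OF rcd_measurable(3)[OF K]]
    measurable_prob_algebraD[OF rcd_measurable(3)[OF L]]
  let ?F = "vimage_algebra (space M) V N"
  have sub: "subalgebra M ?F"
    unfolding subalgebra_def
    by (intro conjI sets_image_in_sets) (auto intro: rcd_measurable[OF K])
  interpret F: sigma_finite_subalgebra M ?F
    by (intro finite_measure_subalgebra_is_sigma_finite finite_measure_subalgebra.intro
        finite_measure_subalgebra_axioms.intro sub) unfold_locales
  have VN: "V \<omega> \<in> space N" if "\<omega> \<in> space M" for \<omega>
    using measurable_space[OF rcd_measurable(1)[OF K] that] .
  have rect: "emeasure M (V -` A \<inter> U -` C \<inter> Z -` B \<inter> space M) =
      (\<integral>\<^sup>+\<omega>. indicator A (V \<omega>) * emeasure (K (V \<omega>)) B * indicator C (U \<omega>) \<partial>M)"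
    if [measurable]: "A \<in> sets N" "C \<in> sets T" "B \<in> sets S" for A B C
  proof -
    let ?I = "indicator (Z -` B \<inter> U -` C \<inter> space M) :: 'a \<Rightarrow> real"
    let ?A = "V -` A \<inter> space M"
    have A: "?A \<in> sets ?F" by (rule in_vimage_algebra) simp
    have I: "integrable M ?I" by (auto intro!: integrable_real_indicator simp: emeasure_eq_measure)
    have ce: "AE \<omega> in M. real_cond_exp M ?F ?I \<omega> = measure (K (V \<omega>)) B * measure (L (V \<omega>)) C"
      using rcd_cond_exp[OF M K \<open>B \<in> sets S\<close>] rcd_cond_exp[OF M L \<open>C \<in> sets T\<close>]
        ind[unfolded cond_indep_def, rule_format, OF \<open>B \<in> sets S\<close> \<open>C \<in> sets T\<close>]
      by eventually_elim simp
    have "(\<integral>\<omega>\<in>?A. ?I \<omega> \<partial>M) = (\<integral>\<omega>\<in>?A. real_cond_exp M ?F ?I \<omega> \<partial>M)"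
      by (rule F.real_cond_exp_intA[OF I A])
    also have "\<dots> = (\<integral>\<omega>\<in>?A. measure (K (V \<omega>)) B * measure (L (V \<omega>)) C \<partial>M)"
      unfolding set_lebesgue_integral_def using ce
      by (intro integral_cong_AE) (auto intro: measurable_from_subalg[OF sub])
    finally have eq: "(\<integral>\<omega>\<in>?A. ?I \<omega> \<partial>M) = \<dots>" .
    have "emeasure M (V -` A \<inter> U -` C \<inter> Z -` B \<inter> space M) = ennreal (\<integral>\<omega>\<in>?A. ?I \<omega> \<partial>M)"
      unfolding set_lebesgue_integral_def emeasure_eq_measure real_scaleR_def
      by (subst indicator_inter_arith[symmetric]) (auto intro!: arg_cong[where f="measure M"])
    also have "\<dots> = (\<integral>\<^sup>+\<omega>. ennreal (indicator ?A \<omega> * (measure (K (V \<omega>)) B * measure (L (V \<omega>)) C)) \<partial>M)"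
      unfolding eq unfolding set_lebesgue_integral_def real_scaleR_def
    proof (rule nn_integral_eq_integral[symmetric])
      show "integrable M (\<lambda>\<omega>. indicator ?A \<omega> * (measure (K (V \<omega>)) B * measure (L (V \<omega>)) C))"
        using prob_space.prob_le_1[OF rcd_kernel(1)[OF K VN]] prob_space.prob_le_1[OF rcd_kernel(1)[OF L VN]]
        by (intro integrable_const_bound[where B=1] AE_I2)
           (auto intro!: mult_le_one split: split_indicator)
    qed auto
    also have "\<dots> = (\<integral>\<^sup>+\<omega>. indicator A (V \<omega>) * emeasure (K (V \<omega>)) B * emeasure (L (V \<omega>)) C \<partial>M)"
    proof (intro nn_integral_cong)
      fix \<omega> assume w: "\<omega> \<in> space M"
      interpret K: prob_space "K (V \<omega>)" by (rule rcd_kernel[OF K VN[OF w]])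
      interpret L: prob_space "L (V \<omega>)" by (rule rcd_kernel[OF L VN[OF w]])
      show "ennreal (indicator ?A \<omega> * (measure (K (V \<omega>)) B * measure (L (V \<omega>)) C)) =
          indicator A (V \<omega>) * emeasure (K (V \<omega>)) B * emeasure (L (V \<omega>)) C"
        using w by (auto simp: K.emeasure_eq_measure L.emeasure_eq_measure ennreal_mult split: split_indicator)
    qed
    also have "\<dots> = (\<integral>\<^sup>+v. indicator A v * emeasure (K v) B * emeasure (L v) C \<partial>distr M N V)"
      by (subst nn_integral_distr) auto
    \<comment> \<open>Written as an integral over \<open>L v\<close>, the mass of \<open>C\<close>
      can be replaced by the indicator of \<open>U\<close> in \<open>C\<close> through the
      disintegration of \<open>U\<close>.\<close>
    also have "\<dots> = (\<integral>\<^sup>+v. \<integral>\<^sup>+u. indicator A v * emeasure (K v) B * indicator C u \<partial>L v \<partial>distr M N V)"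
      by (intro nn_integral_cong) (simp add: nn_integral_cmult rcd_kernel(2)[OF L])
    also have "\<dots> = (\<integral>\<^sup>+\<omega>. indicator A (V \<omega>) * emeasure (K (V \<omega>)) B * indicator C (U \<omega>) \<partial>M)"
      by (rule rcd_nn_integral[OF M L, symmetric,
            where u="\<lambda>(v, u). indicator A v * emeasure (K v) B * indicator C u", simplified])
         measurable
    finally show ?thesis .
  qed
  show ?thesis
    unfolding regular_cond_distr_def
  proof (intro conjI ballI)
    fix G B assume [measurable]: "G \<in> sets (N \<Otimes>\<^sub>M T)" "B \<in> sets S"
    \<comment> \<open>For fixed \<open>B\<close>, both sides of the kernel identity are measures in
      \<open>G\<close>: the law of \<open>(V, U)\<close> restricted to the event that
      \<open>Z\<close> lies in \<open>B\<close>, and the law of \<open>(V, U)\<close> weighted by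
      the kernel. Agreement on rectangles therefore extends to all \<open>G\<close>.\<close>
    let ?P = "distr (density M (indicator (Z -` B \<inter> space M))) (N \<Otimes>\<^sub>M T) (\<lambda>\<omega>. (V \<omega>, U \<omega>))"
    let ?Q = "density (distr M (N \<Otimes>\<^sub>M T) (\<lambda>\<omega>. (V \<omega>, U \<omega>))) (\<lambda>v. emeasure (K (fst v)) B)"
    have P: "emeasure ?P G = emeasure M ((\<lambda>\<omega>. (V \<omega>, U \<omega>)) -` G \<inter> Z -` B \<inter> space M)"
      if [measurable]: "G \<in> sets (N \<Otimes>\<^sub>M T)" for G
    proof -
      have "emeasure ?P G = (\<integral>\<^sup>+\<omega>. indicator (Z -` B \<inter> space M) \<omega> * indicator ((\<lambda>\<omega>. (V \<omega>, U \<omega>)) -` G \<inter> space M) \<omega> \<partial>M)"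
        by (subst emeasure_distr) (auto simp: emeasure_density)
      also have "\<dots> = (\<integral>\<^sup>+\<omega>. indicator ((\<lambda>\<omega>. (V \<omega>, U \<omega>)) -` G \<inter> Z -` B \<inter> space M) \<omega> \<partial>M)"
        by (intro nn_integral_cong) (auto split: split_indicator)
      also have "\<dots> = emeasure M ((\<lambda>\<omega>. (V \<omega>, U \<omega>)) -` G \<inter> Z -` B \<inter> space M)"
        by (rule nn_integral_indicator) measurable
      finally show ?thesis .
    qed
    have "?P = ?Q"
    proof (rule finite_measure_eqI_rectangles[where N=N and S=T])
      have "emeasure ?P (space ?P) \<le> emeasure M (space M)"
        by (subst P) (auto intro!: emeasure_mono simp del: emeasure_space)
      then show "finite_measure ?P"
        by (intro finite_measureI) (auto simp: emeasure_space_1 top_unique)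
      fix A C assume [measurable]: "A \<in> sets N" "C \<in> sets T"
      have "emeasure ?P (A \<times> C) = emeasure M (V -` A \<inter> U -` C \<inter> Z -` B \<inter> space M)"
        by (subst P) (auto intro!: arg_cong2[where f=emeasure])
      also have "\<dots> = (\<integral>\<^sup>+\<omega>. indicator A (V \<omega>) * emeasure (K (V \<omega>)) B * indicator C (U \<omega>) \<partial>M)"
        by (rule rect) measurable
      also have "\<dots> = (\<integral>\<^sup>+\<omega>. emeasure (K (V \<omega>)) B * indicator (A \<times> C) (V \<omega>, U \<omega>) \<partial>M)"
        by (intro nn_integral_cong) (auto split: split_indicator)
      also have "\<dots> = emeasure ?Q (A \<times> C)"
        by (subst emeasure_density) (auto simp: nn_integral_distr)
      finally show "emeasure ?P (A \<times> C) = emeasure ?Q (A \<times> C)" .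
    qed auto
    then have "emeasure ?P G = emeasure ?Q G" by simp
    then show "emeasure M ((\<lambda>\<omega>. (V \<omega>, U \<omega>)) -` G \<inter> Z -` B \<inter> space M) =
        (\<integral>\<^sup>+v. emeasure (K (fst v)) B * indicator G v \<partial>distr M (N \<Otimes>\<^sub>M T) (\<lambda>\<omega>. (V \<omega>, U \<omega>)))"
      by (simp add: P emeasure_density)
  qed measurable
qed

subsection \<open>Supports and comonotone variables\<close>

text \<open>The complement of the support is covered by the basic open sets of measure zero, and a
  countable basis has only countably many of them.\<close>

lemma AE_in_msupport:
  fixes N :: "'b::second_countable_topology measure"
  assumes sets: "sets N = sets borel"
  shows "AE y in N. y \<in> msupport N"
proof -
  obtain \<B> :: "'b set set" where \<B>: "countable \<B>" "topological_basis \<B>"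
    using ex_countable_basis by auto
  let ?C = "{B\<in>\<B>. emeasure N B = 0}"
  have "AE y in N. \<forall>B\<in>?C. y \<notin> B"
  proof (subst AE_ball_countable)
    show "countable ?C" using \<B>(1) by auto
    show "\<forall>B\<in>?C. AE y in N. y \<notin> B"
      using topological_basis_open[OF \<B>(2)]
      by (auto intro!: AE_not_in null_setsI simp: sets)
  qed
  then show ?thesis
  proof eventually_elim
    fix y assume y: "\<forall>B\<in>?C. y \<notin> B"
    show "y \<in> msupport N"
      unfolding msupport_def
    proof (intro CollectI allI impI, elim conjE)
      fix U assume "open U" "y \<in> U"
      then obtain B where B: "B \<in> \<B>" "y \<in> B" "B \<subseteq> U"
        using topological_basisE[OF \<B>(2)] by blast
      have "0 < emeasure N B" using B y by (auto simp: zero_less_iff_neq_zero)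
      also have "\<dots> \<le> emeasure N U"
        using B \<open>open U\<close> by (intro emeasure_mono) (auto simp: sets)
      finally show "0 < emeasure N U" .
    qed
  qed
qed

text \<open>Makes supports Borel sets, so that membership in them is a measurable event.\<close>

lemma closed_msupport:
  fixes N :: "'b::topological_space measure"
  shows "closed (msupport N)"
proof -
  have "- msupport N = \<Union>{U. open U \<and> emeasure N U = 0}"
    by (auto simp: msupport_def zero_less_iff_neq_zero)
  then show ?thesis by (auto simp: closed_def)
qed

text \<open>For each rational threshold, the parts of \<open>C\<close> where \<open>A\<close> and
  where \<open>B\<close> stay below it are nested and have equal mass, hence coincide up to a null
  set. If \<open>A z\<close> and \<open>B z\<close> differed, some rational would separate
  them.\<close>

lemma comonotone_eq_on:
  fixes A B :: "'z \<Rightarrow> real" and V :: "'z \<Rightarrow> 'v::linorder"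
  assumes P: "prob_space P"
    and [measurable]: "A \<in> borel_measurable P" "B \<in> borel_measurable P" "C \<in> sets P"
    and mono: "AE z in P. A z = \<phi> (V z) \<and> B z = \<psi> (V z)" "strict_mono \<phi>" "strict_mono \<psi>"
    and law: "\<And>S. S \<in> sets borel \<Longrightarrow>
      emeasure P {z\<in>space P. z \<in> C \<and> A z \<in> S} = emeasure P {z\<in>space P. z \<in> C \<and> B z \<in> S}"
  shows "AE z in P. z \<in> C \<longrightarrow> A z = B z"
proof -
  interpret prob_space P by fact
  have "AE z in P. z \<in> C \<longrightarrow> (A z \<le> real_of_rat q \<longleftrightarrow> B z \<le> real_of_rat q)" for q
  proof -
    let ?a = "{z\<in>space P. z \<in> C \<and> A z \<le> real_of_rat q}" and ?b = "{z\<in>space P. z \<in> C \<and> B z \<le> real_of_rat q}"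
    have ab: "measure P ?a = measure P ?b"
      using law[of "{..real_of_rat q}"] by (simp add: measure_def)
    define good where "good z \<longleftrightarrow> A z = \<phi> (V z) \<and> B z = \<psi> (V z)" for z
    text \<open>Both sets are, up to a null set, preimages of lower sets under \<open>V\<close>, hence nested.\<close>
    have nested: "B z \<le> q'" if "good z" "good y" "A z \<le> c" "B y \<le> q'" "\<not> A y \<le> c" for z y c q'
    proof -
      have "\<phi> (V z) < \<phi> (V y)" using that by (auto simp: good_def)
      then have "V z < V y" using mono(2) by (simp add: strict_mono_less)
      then have "\<psi> (V z) < \<psi> (V y)" using mono(3) by (simp add: strict_mono_less)
      then show ?thesis using that by (auto simp: good_def)
    qed
    have eq: "AE z in P. z \<in> S \<longleftrightarrow> z \<in> T"
      if "measure P S = measure P T" "AE z in P. z \<in> S \<longrightarrow> z \<in> T" and [measurable]: "S \<in> sets P" "T \<in> sets P" for S T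
    proof -
      have "measure P (T - S) = measure P T - measure P (T \<inter> S)"
        by (rule finite_measure_Diff') auto
      also have "measure P (T \<inter> S) = measure P S"
        using that(2) by (intro measure_eq_AE) auto
      finally have "AE z in P. z \<notin> T - S"
        using that(1) by (intro AE_not_in) (auto simp: null_sets_def emeasure_eq_measure)
      with that(2) show ?thesis by eventually_elim auto
    qed
    have "(\<forall>z. good z \<longrightarrow> z \<in> ?a \<longrightarrow> z \<in> ?b) \<or> (\<forall>z. good z \<longrightarrow> z \<in> ?b \<longrightarrow> z \<in> ?a)"
      using nested by blast
    moreover have "AE z in P. good z" using mono(1) by (simp add: good_def)
    ultimately have "(AE z in P. z \<in> ?a \<longrightarrow> z \<in> ?b) \<or> (AE z in P. z \<in> ?b \<longrightarrow> z \<in> ?a)"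
      by (blast intro: eventually_mono)
    then have "AE z in P. z \<in> ?a \<longleftrightarrow> z \<in> ?b"
    proof
      assume "AE z in P. z \<in> ?a \<longrightarrow> z \<in> ?b"
      then show ?thesis by (intro eq[OF ab]) measurable
    next
      assume "AE z in P. z \<in> ?b \<longrightarrow> z \<in> ?a"
      then have "AE z in P. z \<in> ?b \<longleftrightarrow> z \<in> ?a" by (intro eq[OF ab[symmetric]]) measurable
      then show ?thesis by eventually_elim blast
    qed
    with AE_space show ?thesis by eventually_elim auto
  qed
  then have "AE z in P. \<forall>q. z \<in> C \<longrightarrow> (A z \<le> real_of_rat q \<longleftrightarrow> B z \<le> real_of_rat q)"
    by (intro AE_all_countable[THEN iffD2] allI)
  then show ?thesis
  proof eventually_elim
    fix z assume z: "\<forall>q. z \<in> C \<longrightarrow> (A z \<le> real_of_rat q \<longleftrightarrow> B z \<le> real_of_rat q)"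
    show "z \<in> C \<longrightarrow> A z = B z"
    proof (rule impI, rule ccontr)
      assume "z \<in> C" "A z \<noteq> B z"
      then consider "A z < B z" | "B z < A z" by linarith
      then show False
      proof cases
        case 1
        obtain q where "A z < real_of_rat q" "real_of_rat q < B z" using of_rat_dense[OF 1] by auto
        with z \<open>z \<in> C\<close> show False by (auto dest!: spec[of _ q])
      next
        case 2
        obtain q where "B z < real_of_rat q" "real_of_rat q < A z" using of_rat_dense[OF 2] by auto
        with z \<open>z \<in> C\<close> show False by (auto dest!: spec[of _ q])
      qed
    qed
  qed
qed

text \<open>If \<open>A z < B z\<close>, the values taken on \<open>C\<close> leave a gap between
  \<open>A z\<close> and \<open>B z\<close>. By the support condition these are the exact end points
  of the gap, so a rational inside determines both values. Each rational thus accounts for a single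
  event \<open>A = a\<close>, \<open>B = b\<close>, which is null.\<close>

lemma comonotone_not_less:
  fixes A B :: "'z \<Rightarrow> real" and V :: "'z \<Rightarrow> 'v::linorder"
  assumes P: "prob_space P"
    and [measurable]: "A \<in> borel_measurable P" "B \<in> borel_measurable P" "C \<in> sets P"
    and mono: "AE z in P. A z = \<phi> (V z) \<and> B z = \<psi> (V z)" "strict_mono \<phi>" "strict_mono \<psi>"
    and eq: "AE z in P. z \<in> C \<longrightarrow> A z = B z"
    and supp: "AE z in P. \<forall>U. open U \<and> A z \<in> U \<longrightarrow> 0 < emeasure P {y\<in>space P. y \<in> C \<and> A y \<in> U}"
      "AE z in P. \<forall>U. open U \<and> B z \<in> U \<longrightarrow> 0 < emeasure P {y\<in>space P. y \<in> C \<and> B y \<in> U}"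
    and no_atom: "\<And>a b. AE z in P. \<not> (A z = a \<and> B z = b)"
  shows "AE z in P. \<not> A z < B z"
proof -
  define good where "good z \<longleftrightarrow> (A z = \<phi> (V z) \<and> B z = \<psi> (V z)) \<and>
    (\<forall>U. open U \<and> A z \<in> U \<longrightarrow> 0 < emeasure P {y\<in>space P. y \<in> C \<and> A y \<in> U}) \<and>
    (\<forall>U. open U \<and> B z \<in> U \<longrightarrow> 0 < emeasure P {y\<in>space P. y \<in> C \<and> B y \<in> U})" for z
  have good_supp: "0 < emeasure P {y\<in>space P. y \<in> C \<and> A y \<in> U}" if "good z" "open U" "A z \<in> U" for z U
    using that by (auto simp: good_def)
  have good_supp': "0 < emeasure P {y\<in>space P. y \<in> C \<and> B y \<in> U}" if "good z" "open U" "B z \<in> U" for z U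
    using that by (auto simp: good_def)
  have good: "AE z in P. good z"
    using mono(1) supp unfolding good_def by eventually_elim auto
  text \<open>No mass of \<open>C\<close> can be in between: there both functions agree, and both are increasing in \<open>V\<close>.\<close>
  have gap: "AE y in P. y \<in> C \<longrightarrow> A y = B y \<and> (A y < A z \<or> B z < A y)" if "good z" "A z < B z" for z
    using good eq
  proof eventually_elim
    fix y assume y: "good y" "y \<in> C \<longrightarrow> A y = B y"
    show "y \<in> C \<longrightarrow> A y = B y \<and> (A y < A z \<or> B z < A y)"
    proof (cases "V y" "V z" rule: linorder_cases)
      case less
      then have "\<phi> (V y) < \<phi> (V z)" using mono(2) by (simp add: strict_mono_less)
      with y that show ?thesis by (auto simp: good_def)
    next
      case equal
      with y that show ?thesis by (auto simp: good_def)
    next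
      case greater
      then have "\<psi> (V z) < \<psi> (V y)" using mono(3) by (simp add: strict_mono_less)
      with y that show ?thesis by (auto simp: good_def)
    qed
  qed
  \<comment> \<open>Two gaps containing the same rational have the same end points: an end point of
    one lying strictly inside the other would, by the support condition, carry mass of
    \<open>C\<close> there. Only one pair of inequalities is shown; exchanging \<open>z\<close> and
    \<open>y\<close> gives the reverse.\<close>
  have const: "A z \<ge> A y \<and> B z \<ge> B y"
    if z: "good z" "A z < real_of_rat q" "real_of_rat q < B z"
      and y: "good y" "A y < real_of_rat q" "real_of_rat q < B y" for z y q
  proof (intro conjI; rule ccontr)
    assume "\<not> A z \<ge> A y"
    then have "0 < emeasure P {x\<in>space P. x \<in> C \<and> A x \<in> {A z<..<real_of_rat q}}"
      using y by (intro good_supp[OF y(1)]) auto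
    moreover have "emeasure P {x\<in>space P. x \<in> C \<and> A x \<in> {A z<..<real_of_rat q}} = 0"
    proof (rule emeasure_eq_0_AE)
      show "AE x in P. \<not> (x \<in> C \<and> A x \<in> {A z<..<real_of_rat q})"
        using gap[OF z(1)] z by auto
    qed
    ultimately show False by simp
  next
    assume "\<not> B z \<ge> B y"
    then have "0 < emeasure P {x\<in>space P. x \<in> C \<and> B x \<in> {real_of_rat q<..<B y}}"
      using z by (intro good_supp'[OF z(1)]) auto
    moreover have "emeasure P {x\<in>space P. x \<in> C \<and> B x \<in> {real_of_rat q<..<B y}} = 0"
    proof (rule emeasure_eq_0_AE)
      show "AE x in P. \<not> (x \<in> C \<and> B x \<in> {real_of_rat q<..<B y})"
        using gap[OF y(1)] y by auto
    qed
    ultimately show False by simp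
  qed
  \<comment> \<open>Either no good point has \<open>q\<close> in its gap, or all those that do share
    the values of one witness \<open>y\<close>.\<close>
  have "AE z in P. \<not> (A z < real_of_rat q \<and> real_of_rat q < B z)" for q
  proof (cases "\<exists>y. good y \<and> A y < real_of_rat q \<and> real_of_rat q < B y")
    case True
    then obtain y where y: "good y" "A y < real_of_rat q" "real_of_rat q < B y" by blast
    from good no_atom[of "A y" "B y"] show ?thesis
    proof eventually_elim
      fix z assume z: "good z" "\<not> (A z = A y \<and> B z = B y)"
      show "\<not> (A z < real_of_rat q \<and> real_of_rat q < B z)"
        using const[OF z(1) _ _ y] const[OF y z(1)] z(2) by force
    qed
  next
    case False
    with good show ?thesis by (auto elim!: eventually_mono)
  qed
  then have "AE z in P. \<forall>q. \<not> (A z < real_of_rat q \<and> real_of_rat q < B z)"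
    by (intro AE_all_countable[THEN iffD2] allI)
  then show ?thesis
    by eventually_elim (use of_rat_dense in blast)
qed

lemma comonotone_eq:
  fixes A B :: "'z \<Rightarrow> real" and V :: "'z \<Rightarrow> 'v::linorder"
  assumes P: "prob_space P"
    and meas: "A \<in> borel_measurable P" "B \<in> borel_measurable P" "C \<in> sets P"
    and mono: "AE z in P. A z = \<phi> (V z) \<and> B z = \<psi> (V z)" "strict_mono \<phi>" "strict_mono \<psi>"
    and law: "\<And>S. S \<in> sets borel \<Longrightarrow>
      emeasure P {z\<in>space P. z \<in> C \<and> A z \<in> S} = emeasure P {z\<in>space P. z \<in> C \<and> B z \<in> S}"
    and supp: "AE z in P. \<forall>U. open U \<and> A z \<in> U \<longrightarrow> 0 < emeasure P {y\<in>space P. y \<in> C \<and> A y \<in> U}"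
      "AE z in P. \<forall>U. open U \<and> B z \<in> U \<longrightarrow> 0 < emeasure P {y\<in>space P. y \<in> C \<and> B y \<in> U}"
    and no_atom: "\<And>a b. AE z in P. \<not> (A z = a \<and> B z = b)"
  shows "AE z in P. A z = B z"
proof -
  have eq: "AE z in P. z \<in> C \<longrightarrow> A z = B z"
    by (rule comonotone_eq_on[OF P meas mono law])
  have "AE z in P. \<not> A z < B z"
    by (rule comonotone_not_less[OF P meas mono eq supp no_atom])
  moreover have "AE z in P. \<not> B z < A z"
  \<comment> \<open>All hypotheses are symmetric under exchanging \<open>A\<close> and
    \<open>B\<close>.\<close>
  proof (rule comonotone_not_less[OF P meas(2,1,3) _ mono(3,2) _ supp(2,1)])
    show "AE z in P. B z = \<psi> (V z) \<and> A z = \<phi> (V z)" using mono(1) by eventually_elim auto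
    show "AE z in P. z \<in> C \<longrightarrow> B z = A z" using eq by eventually_elim auto
    show "AE z in P. \<not> (B z = a \<and> A z = b)" for a b using no_atom[of b a] by eventually_elim auto
  qed
  ultimately show ?thesis by eventually_elim auto
qed

text \<open>The variables that switch from \<open>A\<close> to \<open>B\<close> at \<open>c1\<close>
  and at \<open>c2\<close> coincide unless \<open>eta\<close> lies between the two thresholds.
  Cancelling the common part of their laws leaves equality in law of \<open>A\<close> and
  \<open>B\<close> on the compliers, which is what \<open>comonotone_eq\<close> requires.\<close>

lemma switching_law_eq_iff:
  fixes eta A B :: "'z \<Rightarrow> real" and V :: "'z \<Rightarrow> 'v::linorder" and h1 h2 :: "real \<Rightarrow> real"
  assumes P: "prob_space P"
    and [measurable]: "eta \<in> borel_measurable P" "A \<in> borel_measurable P" "B \<in> borel_measurable P"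
    and c: "c1 \<le> c2"
    and [measurable]: "h1 \<in> borel_measurable borel" "h2 \<in> borel_measurable borel"
    and law1: "distr P borel (\<lambda>z. if eta z \<le> c1 then A z else B z) = density lborel (\<lambda>w. ennreal (h1 w))"
    and law2: "distr P borel (\<lambda>z. if eta z \<le> c2 then A z else B z) = density lborel (\<lambda>w. ennreal (h2 w))"
    and h_nonneg: "AE w in lborel. 0 \<le> h1 w" "AE w in lborel. 0 \<le> h2 w"
    and mono: "AE z in P. A z = \<phi> (V z) \<and> B z = \<psi> (V z)" "strict_mono \<phi>" "strict_mono \<psi>"
    and supp: "AE z in P. \<forall>U. open U \<and> A z \<in> U \<longrightarrow> 0 < emeasure P {y\<in>space P. eta y \<in> {c1<..c2} \<and> A y \<in> U}"
      "AE z in P. \<forall>U. open U \<and> B z \<in> U \<longrightarrow> 0 < emeasure P {y\<in>space P. eta y \<in> {c1<..c2} \<and> B y \<in> U}"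
  shows "(AE z in P. A z = B z) \<longleftrightarrow> (AE w in lborel. h2 w = h1 w)"
proof -
  interpret prob_space P by fact
  let ?W = "\<lambda>c z. if eta z \<le> c then A z else B z"
  \<comment> \<open>As \<open>ennreal\<close> sends negative numbers to zero, nonnegativity is what
    allows real equality to be recovered.\<close>
  have "AE w in lborel. (h2 w = h1 w) \<longleftrightarrow> (ennreal (h2 w) = ennreal (h1 w))"
    using h_nonneg by eventually_elim simp
  then have "(AE w in lborel. h2 w = h1 w) \<longleftrightarrow> (AE w in lborel. ennreal (h2 w) = ennreal (h1 w))"
    by (rule eventually_subst)
  also have "\<dots> \<longleftrightarrow> distr P borel (?W c2) = distr P borel (?W c1)"
    unfolding law1 law2 by (intro sigma_finite_measure.density_unique_iff[symmetric] sigma_finite_lborel) auto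
  finally have "(AE w in lborel. h2 w = h1 w) \<longleftrightarrow> distr P borel (?W c2) = distr P borel (?W c1)" .
  also have "\<dots> \<longleftrightarrow> (AE z in P. A z = B z)"
  proof
    assume "AE z in P. A z = B z"
    then show "distr P borel (?W c2) = distr P borel (?W c1)"
      by (intro distr_cong_AE) (auto elim: eventually_mono)
  next
    assume eq: "distr P borel (?W c2) = distr P borel (?W c1)"
    let ?C = "{z\<in>space P. eta z \<in> {c1<..c2}}"
    have C: "{y\<in>space P. y \<in> ?C \<and> Q y} = {y\<in>space P. eta y \<in> {c1<..c2} \<and> Q y}" for Q by auto
    show "AE z in P. A z = B z"
    proof (rule comonotone_eq[where C="?C", OF P _ _ _ mono, unfolded C])
      fix S :: "real set" assume [measurable]: "S \<in> sets borel"
      let ?lo = "{z\<in>space P. eta z \<le> c1 \<and> A z \<in> S}" and ?hi = "{z\<in>space P. c2 < eta z \<and> B z \<in> S}"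
      let ?a = "{z\<in>space P. eta z \<in> {c1<..c2} \<and> A z \<in> S}" and ?b = "{z\<in>space P. eta z \<in> {c1<..c2} \<and> B z \<in> S}"
      \<comment> \<open>Both preimages split into three disjoint pieces, of which \<open>?lo\<close>
        and \<open>?hi\<close> are shared. Passing to real-valued measure permits the
        cancellation.\<close>
      have "measure P (?W c2 -` S \<inter> space P) = measure P (?W c1 -` S \<inter> space P)"
        using arg_cong[OF eq, of "\<lambda>N. measure N S"] by (simp add: measure_distr)
      also have "?W c2 -` S \<inter> space P = ?lo \<union> ?a \<union> ?hi" using c by (auto split: if_splits)
      also have "measure P \<dots> = measure P ?lo + measure P ?a + measure P ?hi"
        using c by (subst finite_measure_Union; (subst finite_measure_Union)?; auto)
      also have "?W c1 -` S \<inter> space P = ?lo \<union> ?b \<union> ?hi" using c by (auto split: if_splits)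
      also have "measure P \<dots> = measure P ?lo + measure P ?b + measure P ?hi"
        using c by (subst finite_measure_Union; (subst finite_measure_Union)?; auto)
      finally show "emeasure P ?a = emeasure P ?b" by (simp add: emeasure_eq_measure)
    next
      fix a b
      have null: "AE z in P. ?W c2 z \<noteq> d" for d
      proof -
        have "AE w in distr P borel (?W c2). w \<noteq> d"
          unfolding law2 using AE_lborel_singleton[of d] by (subst AE_density) (auto elim: eventually_mono)
        then show ?thesis by (subst (asm) AE_distr_iff) auto
      qed
      \<comment> \<open>The variable switching at \<open>c2\<close> takes the value
        \<open>A z\<close> or \<open>B z\<close>, hence \<open>a\<close> or \<open>b\<close> on this
        event, and its law has a density and therefore no atoms.\<close>
      show "AE z in P. \<not> (A z = a \<and> B z = b)"
        using null[of a] null[of b] by eventually_elim (auto split: if_splits)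
    qed (use supp in auto)
  qed
  finally show ?thesis by simp
qed

subsection \<open>One-sided limits at the cutoff\<close>

lemma AE_lborel_interval_ex:
  fixes a b :: real
  assumes "AE r in lborel. Q r" "a < b"
  shows "\<exists>r. a < r \<and> r < b \<and> Q r"
proof (rule ccontr)
  assume *: "\<not> ?thesis"
  have "AE r in lborel. r \<notin> {a<..<b}"
    using assms(1) by eventually_elim (use * in auto)
  then have "emeasure lborel {a<..<b} = 0"
    using emeasure_eq_0_AE[of "\<lambda>r. r \<in> {a<..<b}" lborel]
    by (simp del: greaterThanLessThan_iff)
  with assms(2) show False by simp
qed

lemma AE_lborel_continuous_eq:
  fixes f g :: "real \<Rightarrow> real"
  assumes ae: "AE w in lborel. f w = g w" and cont: "continuous_on UNIV f" "continuous_on UNIV g"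
  shows "f w = g w"
proof (rule ccontr)
  assume w: "f w \<noteq> g w"
  have "open {w. f w \<noteq> g w}" using cont by (rule open_Collect_neq)
  with w obtain e where e: "0 < e" "ball w e \<subseteq> {w. f w \<noteq> g w}"
    by (auto simp: open_contains_ball)
  obtain r where "w < r" "r < w + e" "f r = g r"
    using AE_lborel_interval_ex[OF ae, of w "w + e"] e(1) by auto
  moreover from this have "r \<in> ball w e" by (auto simp: dist_real_def)
  ultimately show False using e(2) by auto
qed

text \<open>Replaces a property known at almost every \<open>r\<close> of positive density by a
  sequence along which it holds at every index.\<close>

lemma AE_sequence_at_right:
  fixes a :: real
  assumes ae: "AE r in lborel. 0 < \<phi> r \<longrightarrow> Q r" and pos: "eventually (\<lambda>r. 0 < (\<phi> r :: real)) (nhds a)"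
  shows "\<exists>s. filterlim s (at_right a) sequentially \<and> (\<forall>n::nat. Q (s n))"
proof -
  obtain e where e: "0 < e" "\<And>r. dist r a < e \<Longrightarrow> 0 < \<phi> r"
    using pos by (auto simp: eventually_nhds_metric)
  \<comment> \<open>The bound \<open>e\<close> keeps the point where \<open>\<phi>\<close> is
    positive, and \<open>1 / Suc n\<close> forces convergence.\<close>
  have "\<exists>r. a < r \<and> r < a + min e (1 / Suc n) \<and> (0 < \<phi> r \<longrightarrow> Q r)" for n
    using e(1) by (intro AE_lborel_interval_ex[OF ae]) auto
  then obtain s where s: "\<And>n. a < s n" "\<And>n. s n < a + min e (1 / Suc n)" "\<And>n. 0 < \<phi> (s n) \<longrightarrow> Q (s n)"
    by metis
  have "Q (s n)" for n
    using s[of n] e(2)[of "s n"] by (auto simp: dist_real_def)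
  moreover have "s \<longlonglongrightarrow> a"
  proof (rule tendsto_sandwich[of "\<lambda>_. a" s _ "\<lambda>n. a + 1 / Suc n"])
    show "(\<lambda>n. a + 1 / Suc n) \<longlonglongrightarrow> a"
      using tendsto_add[OF tendsto_const LIMSEQ_inverse_real_of_nat, of a] by (simp add: inverse_eq_divide)
    show "\<forall>\<^sub>F n in sequentially. s n \<le> a + 1 / real (Suc n)"
      using s(2) by (intro always_eventually allI) (meson min.strict_boundedE add_less_cancel_left less_imp_le less_le_trans min.cobounded2 add_left_mono)
  qed (use s(1) in \<open>auto intro!: always_eventually less_imp_le\<close>)
  moreover have "\<forall>n. s n > a \<and> s n \<noteq> a" using s(1) by (metis less_irrefl)
  ultimately show ?thesis
    by (auto simp: filterlim_at intro!: exI[of _ s])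
qed

text \<open>Reflection preserves Lebesgue measure and reduces this to the right-hand case at
  \<open>- a\<close>.\<close>

lemma AE_sequence_at_left:
  fixes a :: real
  assumes ae: "AE r in lborel. 0 < \<phi> r \<longrightarrow> Q r" and pos: "eventually (\<lambda>r. 0 < (\<phi> r :: real)) (nhds a)"
  shows "\<exists>s. filterlim s (at_left a) sequentially \<and> (\<forall>n::nat. Q (s n))"
proof -
  have ae': "AE r in lborel. 0 < \<phi> (- r) \<longrightarrow> Q (- r)"
  proof -
    have "AE r in distr (lborel :: real measure) borel uminus. 0 < \<phi> r \<longrightarrow> Q r"
      unfolding lborel_distr_uminus by (rule ae)
    then show ?thesis
      by (rule AE_distrD[rotated]) simp
  qed
  have "filterlim uminus (nhds a) (nhds (- a))"
    using tendsto_minus[of "\<lambda>r. r" "- a" "nhds (- a)"] by (simp add: filterlim_ident)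
  then have pos': "eventually (\<lambda>r. 0 < \<phi> (- r)) (nhds (- a))"
    using pos by (rule eventually_compose_filterlim[rotated])
  obtain s where s: "filterlim s (at_right (- a)) sequentially" "\<And>n::nat. Q (- s n)"
    using AE_sequence_at_right[OF ae' pos'] by auto
  have "filterlim (\<lambda>n. - s n) (at_left a) sequentially"
    using s(1) tendsto_minus[of s "- a" sequentially] by (auto simp: filterlim_at elim: eventually_mono)
  then show ?thesis using s(2) by (intro exI[of _ "\<lambda>n. - s n"]) auto
qed

text \<open>Characteristic functions converge to that of \<open>Wl\<close> by dominated convergence.
  As the limit \<open>l\<close> keeps unit mass, Scheffe's lemma upgrades pointwise convergence of
  densities to convergence in L1, so they also converge to the characteristic function of
  \<open>l\<close>. Levy's uniqueness theorem then identifies the two laws.\<close>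

lemma limit_law_density:
  fixes Ws :: "nat \<Rightarrow> 'z \<Rightarrow> real" and f :: "nat \<Rightarrow> real \<Rightarrow> real"
  assumes P: "prob_space P"
    and Ws [measurable]: "\<And>n. Ws n \<in> borel_measurable P" and Wl [measurable]: "Wl \<in> borel_measurable P"
    and Ws_lim: "AE z in P. (\<lambda>n. Ws n z) \<longlonglongrightarrow> Wl z"
    and f [measurable]: "\<And>n. f n \<in> borel_measurable borel" and f_nonneg: "\<And>n w. 0 \<le> f n w"
    and law: "\<And>n. distr P borel (Ws n) = density lborel (\<lambda>w. ennreal (f n w))"
    and l [measurable]: "l \<in> borel_measurable borel"
    and f_lim: "AE w in lborel. (\<lambda>n. f n w) \<longlonglongrightarrow> l w"
    and int_l: "(\<integral>\<^sup>+w. ennreal (l w) \<partial>lborel) = 1"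
  shows "distr P borel Wl = density lborel (\<lambda>w. ennreal (l w))"
proof -
  interpret P: prob_space P by fact
  have l_nonneg: "AE w in lborel. 0 \<le> l w"
    using f_lim by eventually_elim (rule LIMSEQ_le_const, auto simp: f_nonneg)
  have int_f: "(\<integral>\<^sup>+w. ennreal (f n w) \<partial>lborel) = 1" for n
  proof -
    have "emeasure (distr P borel (Ws n)) UNIV = 1"
      by (subst emeasure_distr) (auto simp: P.emeasure_space_1)
    then show ?thesis unfolding law by (simp add: emeasure_density)
  qed
  have int_norm_l: "(\<integral>\<^sup>+w. ennreal (norm (l w)) \<partial>lborel) = 1"
    unfolding int_l[symmetric] using l_nonneg by (intro nn_integral_cong_AE) auto
  then have integrable_l: "integrable lborel l" by (intro integrableI_bounded) auto
  have integrable_f: "integrable lborel (f n)" for n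
    using int_f f_nonneg by (intro integrableI_bounded) auto
  have L1: "(\<lambda>n. \<integral>\<^sup>+w. norm (f n w - l w) \<partial>lborel) \<longlonglongrightarrow> 0"
    using integrable_l f_lim int_f int_norm_l f_nonneg by (intro Scheffe_lemma2) auto
  let ?D = "density lborel (\<lambda>w. ennreal (l w))"
  have rdD: "real_distribution ?D"
    using int_l
    by (auto simp: real_distribution_def real_distribution_axioms_def emeasure_density intro!: prob_spaceI)
  have "char (distr P borel Wl) t = char ?D t" for t
  proof (rule LIMSEQ_unique)
    have "(\<lambda>n. \<integral>z. iexp (t * Ws n z) \<partial>P) \<longlonglongrightarrow> (\<integral>z. iexp (t * Wl z) \<partial>P)"
    proof (rule integral_dominated_convergence[where w="\<lambda>_. 1"])
      show "AE z in P. (\<lambda>n. iexp (t * Ws n z)) \<longlonglongrightarrow> iexp (t * Wl z)"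
        using Ws_lim by eventually_elim (intro tendsto_intros)
    qed auto
    then show "(\<lambda>n. char (distr P borel (Ws n)) t) \<longlonglongrightarrow> char (distr P borel Wl) t"
      by (simp add: char_def integral_distr)
    have "(\<lambda>n. char (distr P borel (Ws n)) t - char ?D t) \<longlonglongrightarrow> 0"
    proof (rule tendsto_norm_zero_cancel, rule tendsto_sandwich[where f="\<lambda>_. 0"])
      have "char (distr P borel (Ws n)) t - char ?D t = (\<integral>w. (f n w - l w) *\<^sub>R iexp (t * w) \<partial>lborel)" for n
      proof -
        have i: "integrable lborel (\<lambda>w. h w *\<^sub>R iexp (t * w))" if "integrable lborel h" for h :: "real \<Rightarrow> real"
          by (rule Bochner_Integration.integrable_bound[OF that])
             (use that in \<open>auto intro!: borel_measurable_scaleR\<close>)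
        show ?thesis
          unfolding law char_def using f_nonneg l_nonneg i[OF integrable_f] i[OF integrable_l]
          by (simp add: integral_density scaleR_diff_left)
      qed
      \<comment> \<open>The L1 distance of the densities bounds the difference uniformly in
        \<open>t\<close>. In the non-integrable case the integral has default value zero and the
        bound is trivial.\<close>
      then have "ennreal (norm (char (distr P borel (Ws n)) t - char ?D t)) \<le> (\<integral>\<^sup>+w. norm (f n w - l w) \<partial>lborel)" for n
        using integral_norm_bound_ennreal[of lborel "\<lambda>w. (f n w - l w) *\<^sub>R iexp (t * w)"]
          integrable_f[of n] integrable_l
        by (cases "integrable lborel (\<lambda>w. (f n w - l w) *\<^sub>R iexp (t * w))")
           (auto simp: not_integrable_integral_eq)
      then show "\<forall>\<^sub>F n in sequentially. norm (char (distr P borel (Ws n)) t - char ?D t) \<le> enn2real (\<integral>\<^sup>+w. norm (f n w - l w) \<partial>lborel)"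
      proof (intro always_eventually allI)
        fix n
        assume *: "\<And>n. ennreal (norm (char (distr P borel (Ws n)) t - char ?D t)) \<le> (\<integral>\<^sup>+w. norm (f n w - l w) \<partial>lborel)"
        have "integrable lborel (\<lambda>w. f n w - l w)" using integrable_f integrable_l by auto
        then have "(\<integral>\<^sup>+w. norm (f n w - l w) \<partial>lborel) < \<infinity>" by (simp add: integrable_iff_bounded)
        with *[of n] show "norm (char (distr P borel (Ws n)) t - char ?D t) \<le> enn2real (\<integral>\<^sup>+w. norm (f n w - l w) \<partial>lborel)"
          by (metis enn2real_mono enn2real_ennreal norm_ge_zero infinity_ennreal_def)
      qed
      show "(\<lambda>n. enn2real (\<integral>\<^sup>+w. norm (f n w - l w) \<partial>lborel)) \<longlonglongrightarrow> 0"
        using tendsto_enn2real[where l=0] L1 by simp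
    qed auto
    then show "(\<lambda>n. char (distr P borel (Ws n)) t) \<longlonglongrightarrow> char ?D t"
      by (simp add: LIM_zero_iff)
  qed
  then show ?thesis
    by (intro Levy_uniqueness rdD P.real_distribution_distr Wl) auto
qed

text \<open>The filter \<open>F\<close> covers both sides of the cutoff at once. The switching
  variables converge except possibly where \<open>eta z = c\<close>, since there the comparison with
  \<open>th\<close> may oscillate; that event is null.\<close>

lemma cutoff_limit_law:
  fixes eta :: "'z \<Rightarrow> real" and G1 G0 :: "real \<Rightarrow> 'z \<Rightarrow> real" and f :: "real \<Rightarrow> real \<Rightarrow> real"
  assumes P: "prob_space P"
    and eta [measurable]: "eta \<in> borel_measurable P"
    and G [measurable]: "\<And>r. G1 r \<in> borel_measurable P" "\<And>r. G0 r \<in> borel_measurable P"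
    and G_cont: "\<And>z. isCont (\<lambda>r. G1 r z) a" "\<And>z. isCont (\<lambda>r. G0 r z) a"
    and F: "F \<le> at a" and s: "filterlim s F sequentially"
    and th: "(th \<longlongrightarrow> c) F"
    and no_atom: "AE z in P. eta z \<noteq> c"
    and f [measurable]: "\<And>r. f r \<in> borel_measurable borel" and f_nonneg: "\<And>r w. 0 \<le> f r w"
    and law: "\<And>n. distr P borel (\<lambda>z. if eta z \<le> th (s n) then G1 (s n) z else G0 (s n) z) =
      density lborel (\<lambda>w. ennreal (f (s n) w))"
    and f_lim: "AE w in lborel. ((\<lambda>r. f r w) \<longlongrightarrow> l w) F"
    and int_l: "(\<integral>\<^sup>+w. ennreal (l w) \<partial>lborel) = 1"
  shows "\<exists>h\<in>borel_measurable borel. (AE w in lborel. h w = l w) \<and> (AE w in lborel. 0 \<le> h w) \<and>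
    distr P borel (\<lambda>z. if eta z \<le> c then G1 a z else G0 a z) = density lborel (\<lambda>w. ennreal (h w))"
proof -
  \<comment> \<open>The one-sided limits are unspecified where they fail to exist, so
    \<open>l\<close> need not be measurable. The limit along \<open>s\<close> is a measurable
    version of it.\<close>
  define h where "h w = lim (\<lambda>n. f (s n) w)" for w
  have h [measurable]: "h \<in> borel_measurable borel"
    unfolding h_def by (rule borel_measurable_lim_metric) simp
  have lims: "AE w in lborel. (\<lambda>n. f (s n) w) \<longlonglongrightarrow> l w"
    using f_lim by eventually_elim (rule filterlim_compose[OF _ s])
  then have hl: "AE w in lborel. h w = l w"
    by eventually_elim (simp add: h_def limI)
  have "AE w in lborel. 0 \<le> h w"
    using lims hl by eventually_elim (auto intro: LIMSEQ_le_const f_nonneg)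
  moreover have "distr P borel (\<lambda>z. if eta z \<le> c then G1 a z else G0 a z) = density lborel (\<lambda>w. ennreal (h w))"
  proof (rule limit_law_density[OF P _ _ _ _ _ law h])
    show "AE z in P. (\<lambda>n. if eta z \<le> th (s n) then G1 (s n) z else G0 (s n) z)
        \<longlonglongrightarrow> (if eta z \<le> c then G1 a z else G0 a z)"
      using no_atom
    proof eventually_elim
      fix z assume z: "eta z \<noteq> c"
      have ths: "(\<lambda>n. th (s n)) \<longlonglongrightarrow> c" by (rule filterlim_compose[OF th s])
      have sa: "filterlim s (at a) sequentially" using s F by (rule filterlim_mono) simp
      have G1s: "(\<lambda>n. G1 (s n) z) \<longlonglongrightarrow> G1 a z" and G0s: "(\<lambda>n. G0 (s n) z) \<longlonglongrightarrow> G0 a z"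
        using filterlim_compose[OF G_cont(1)[of z, unfolded isCont_def] sa]
          filterlim_compose[OF G_cont(2)[of z, unfolded isCont_def] sa] .
      show "(\<lambda>n. if eta z \<le> th (s n) then G1 (s n) z else G0 (s n) z)
        \<longlonglongrightarrow> (if eta z \<le> c then G1 a z else G0 a z)"
      \<comment> \<open>Once \<open>th (s n)\<close> lies on the same side of \<open>eta z\<close>
        as \<open>c\<close>, only one branch is ever taken.\<close>
      proof (cases "eta z < c")
        case True
        then have "eventually (\<lambda>n. G1 (s n) z = (if eta z \<le> th (s n) then G1 (s n) z else G0 (s n) z)) sequentially"
          using order_tendstoD(1)[OF ths True] by (auto elim!: eventually_mono)
        from Lim_transform_eventually[OF G1s this] True show ?thesis by simp
      next
        case False
        with z have "c < eta z" by simp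
        then have "eventually (\<lambda>n. G0 (s n) z = (if eta z \<le> th (s n) then G1 (s n) z else G0 (s n) z)) sequentially"
          using order_tendstoD(2)[OF ths \<open>c < eta z\<close>] by (auto elim!: eventually_mono)
        from Lim_transform_eventually[OF G0s this] \<open>c < eta z\<close> show ?thesis by simp
      qed
    qed
    show "AE w in lborel. (\<lambda>n. f (s n) w) \<longlonglongrightarrow> h w"
      using lims hl by eventually_elim simp
    show "(\<integral>\<^sup>+w. ennreal (h w) \<partial>lborel) = 1"
      unfolding int_l[symmetric] using hl by (intro nn_integral_cong_AE) (auto elim: eventually_mono)
  qed (use f_nonneg in measurable)
  ultimately show ?thesis using h hl by blast
qed

lemma left_lim_tendsto: "has_left_lim f \<Longrightarrow> (f \<longlongrightarrow> left_lim f) (at_left 0)"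
  unfolding has_left_lim_def left_lim_def
  using tendsto_Lim[of "at_left 0" f] trivial_limit_at_left_real by blast

lemma right_lim_tendsto: "has_right_lim f \<Longrightarrow> (f \<longlongrightarrow> right_lim f) (at_right 0)"
  unfolding has_right_lim_def right_lim_def
  using tendsto_Lim[of "at_right 0" f] trivial_limit_at_right_real by blast

text \<open>Concerns the Borel sigma-algebra of the product topology, on which the measures
  \<open>K x\<close> live.\<close>

lemma fst_in_borel_measurable [measurable]: "fst \<in> borel_measurable borel"
  by (intro borel_measurable_continuous_onI continuous_intros)

lemma snd_in_borel_measurable [measurable]: "snd \<in> borel_measurable borel"
  by (intro borel_measurable_continuous_onI continuous_intros)

text \<open>A law fixes its density only up to null sets, hence the equality for almost every
  \<open>w\<close>, and for every \<open>w\<close> once the limits are continuous.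
  \<open>A3_eta_no_atom\<close> excludes mass of \<eta> at the two limiting thresholds, where the
  limit of the treatment decision is ambiguous; \<open>fW_limits_densities\<close> prevents escape
  of mass.\<close>

theorem proposition2:
  fixes M :: "'a measure"
    and XX :: "(real ^ 'd) set" and X :: "'a \<Rightarrow> real ^ 'd"
    and R eta D Y W :: "'a \<Rightarrow> real" and eps :: "'a \<Rightarrow> real ^ 'e"
    and g :: "real \<Rightarrow> real \<Rightarrow> real ^ 'd \<Rightarrow> real ^ 'e \<Rightarrow> real"
    and theta :: "real ^ 'd \<Rightarrow> real \<Rightarrow> real"
    and gt :: "real \<Rightarrow> real ^ 'd \<Rightarrow> real \<Rightarrow> real" and nu :: "real ^ 'd \<Rightarrow> real ^ 'e \<Rightarrow> real"
    and fR :: "real ^ 'd \<Rightarrow> real \<Rightarrow> real"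
    and K :: "real ^ 'd \<Rightarrow> (real \<times> (real ^ 'e)) measure"
    and p mu :: "(real ^ 'd) \<times> real \<Rightarrow> real" and tau :: "real ^ 'd \<Rightarrow> real"
    and fW :: "(real ^ 'd) \<times> real \<Rightarrow> real \<Rightarrow> real"
  assumes prob: "prob_space M"
    and rv: "X \<in> borel_measurable M" "R \<in> borel_measurable M"
            "eta \<in> borel_measurable M" "eps \<in> borel_measurable M"
    and XX: "XX \<in> sets borel" "\<And>\<omega>. \<omega> \<in> space M \<Longrightarrow> X \<omega> \<in> XX"
    and g_measurable: "\<And>d. d \<in> {0, 1} \<Longrightarrow> (\<lambda>(r, x, e). g d r x e) \<in> borel_measurable borel"
    and Y: "\<And>\<omega>. \<omega> \<in> space M \<Longrightarrow> Y \<omega> = g (D \<omega>) (R \<omega>) (X \<omega>) (eps \<omega>)"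
    and fR: "cond_density M borel X R fR"
    and K: "regular_cond_distr M borel X borel (\<lambda>\<omega>. (eta \<omega>, eps \<omega>)) K"
    and p: "cond_mean M borel (\<lambda>\<omega>. (X \<omega>, R \<omega>)) (indicator {\<omega> \<in> space M. D \<omega> = 1}) p"
    and mu: "cond_mean M borel (\<lambda>\<omega>. (X \<omega>, R \<omega>)) Y mu"
    and A1_continuous: "uniform_limit XX (\<lambda>r x. fR x r) (\<lambda>x. fR x 0) (at 0)"
    and A1_positive: "\<And>x. x \<in> XX \<Longrightarrow> eventually (\<lambda>r. 0 < fR x r) (nhds 0)"
    and A2: "\<exists>c>0. \<forall>x\<in>XX. measure (density lborel (\<lambda>r. ennreal (fR x r))) {0..} \<in> {c..1 - c}"
    and A3_treatment:
      "\<And>\<omega>. \<omega> \<in> space M \<Longrightarrow> D \<omega> = (if theta (X \<omega>) (R \<omega>) \<ge> eta \<omega> then 1 else 0)"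
    and A3_theta_measurable: "(\<lambda>(x, r). theta x r) \<in> borel_measurable borel"
    and A3_theta_continuous:
      "\<And>x. x \<in> XX \<Longrightarrow> continuous_on {..<0} (theta x)"
      "\<And>x. x \<in> XX \<Longrightarrow> continuous_on {0<..} (theta x)"
      "\<And>x. x \<in> XX \<Longrightarrow> has_left_lim (theta x)"
      "\<And>x. x \<in> XX \<Longrightarrow> has_right_lim (theta x)"
    and A3_theta_jump: "\<And>x. x \<in> XX \<Longrightarrow> left_lim (theta x) < right_lim (theta x)"
    and A3_indep: "cond_indep M (vimage_algebra (space M) X borel)
                     borel (\<lambda>\<omega>. (eta \<omega>, eps \<omega>)) borel R"
    and A3_eta_cdf: "\<And>x. x \<in> XX \<Longrightarrow> strict_mono (cdf (distr (K x) borel fst))"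
    and A3_eta_no_atom:
      "\<And>x. x \<in> XX \<Longrightarrow> isCont (cdf (distr (K x) borel fst)) (left_lim (theta x))"
      "\<And>x. x \<in> XX \<Longrightarrow> isCont (cdf (distr (K x) borel fst)) (right_lim (theta x))"
    and A4_continuous:
      "\<And>d x e. d \<in> {0, 1} \<Longrightarrow> x \<in> XX \<Longrightarrow>
         \<exists>\<delta>>0. continuous_on {-\<delta><..<\<delta>} (\<lambda>r. g d r x e)"
    and A4_gt_measurable:
      "(\<lambda>((d, x), v). gt d x v) \<in> borel_measurable
         (restrict_space borel (msupport (distr M borel (\<lambda>\<omega>. (D \<omega>, X \<omega>))) \<times> UNIV))"
    and A4_gt_increasing:
      "\<And>d x. (d, x) \<in> msupport (distr M borel (\<lambda>\<omega>. (D \<omega>, X \<omega>))) \<Longrightarrow> strict_mono (gt d x)"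
    and A4_factor:
      "\<And>d x e. (d, x) \<in> msupport (distr M borel (\<lambda>\<omega>. (D \<omega>, X \<omega>))) \<Longrightarrow>
         (x, e) \<in> msupport (distr M borel (\<lambda>\<omega>. (X \<omega>, eps \<omega>))) \<Longrightarrow>
         g d 0 x e = gt d x (nu x e)"
    and A5:
      "\<And>d x. d \<in> {0, 1} \<Longrightarrow> x \<in> XX \<Longrightarrow>
         msupport (distr (uniform_measure (K x) {z. fst z \<in> compliers theta x}) borel
                     (\<lambda>z. g d 0 x (snd z))) =
         msupport (distr (K x) borel (\<lambda>z. g d 0 x (snd z)))"
    and p_limits: "\<And>x. x \<in> XX \<Longrightarrow> has_left_lim (\<lambda>r. p (x, r))"
                  "\<And>x. x \<in> XX \<Longrightarrow> has_right_lim (\<lambda>r. p (x, r))"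
    and mu_limits: "\<And>x. x \<in> XX \<Longrightarrow> has_left_lim (\<lambda>r. mu (x, r))"
                   "\<And>x. x \<in> XX \<Longrightarrow> has_right_lim (\<lambda>r. mu (x, r))"
    and tau: "\<And>x. x \<in> XX \<Longrightarrow>
        tau x = (right_lim (\<lambda>r. mu (x, r)) - left_lim (\<lambda>r. mu (x, r))) /
                (right_lim (\<lambda>r. p (x, r)) - left_lim (\<lambda>r. p (x, r)))"
    and W: "\<And>\<omega>. \<omega> \<in> space M \<Longrightarrow> W \<omega> = Y \<omega> + (1 - D \<omega>) * tau (X \<omega>)"
    and fW: "cond_density M borel (\<lambda>\<omega>. (X \<omega>, R \<omega>)) W fW"
    and fW_limits:
      "\<And>x. x \<in> XX \<Longrightarrow> AE w in lborel. has_left_lim (\<lambda>r. fW (x, r) w)"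
      "\<And>x. x \<in> XX \<Longrightarrow> AE w in lborel. has_right_lim (\<lambda>r. fW (x, r) w)"
    and fW_limits_densities:
      "\<And>x. x \<in> XX \<Longrightarrow> (\<integral>\<^sup>+w. ennreal (left_lim (\<lambda>r. fW (x, r) w)) \<partial>lborel) = 1"
      "\<And>x. x \<in> XX \<Longrightarrow> (\<integral>\<^sup>+w. ennreal (right_lim (\<lambda>r. fW (x, r) w)) \<partial>lborel) = 1"
  shows "(homogeneous_effect_at_cutoff (distr M borel X) K g tau \<longleftrightarrow>
           (AE x in distr M borel X. AE w in lborel.
              right_lim (\<lambda>r. fW (x, r) w) = left_lim (\<lambda>r. fW (x, r) w))) \<and>
         ((\<forall>x\<in>XX. continuous_on UNIV (\<lambda>w. right_lim (\<lambda>r. fW (x, r) w)) \<and>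
                   continuous_on UNIV (\<lambda>w. left_lim (\<lambda>r. fW (x, r) w))) \<longrightarrow>
          (homogeneous_effect_at_cutoff (distr M borel X) K g tau \<longleftrightarrow>
            (AE x in distr M borel X. \<forall>w.
               right_lim (\<lambda>r. fW (x, r) w) = left_lim (\<lambda>r. fW (x, r) w))))"
proof -
  interpret prob_space M by (rule prob)
  note [measurable] = rv

  \<comment> \<open>Versions of the conditional laws, and measurability\<close>
  let ?PX = "distr M borel X"
  let ?Z = "\<lambda>\<omega>. (eta \<omega>, eps \<omega>)"
  let ?XR = "\<lambda>\<omega>. (X \<omega>, R \<omega>)"
  have fR_meas: "(\<lambda>(x, r). fR x r) \<in> borel_measurable (borel \<Otimes>\<^sub>M lborel)"
    and rR: "regular_cond_distr M borel X borel R (\<lambda>x. density lborel (\<lambda>r. ennreal (fR x r)))"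
    using fR by (auto simp: cond_density_def)
  have fW_meas: "(\<lambda>(v, w). fW v w) \<in> borel_measurable (borel \<Otimes>\<^sub>M lborel)"
    and fW_nonneg: "\<And>v w. 0 \<le> fW v w"
    and rW: "regular_cond_distr M borel ?XR borel W (\<lambda>v. density lborel (\<lambda>w. ennreal (fW v w)))"
    using fW by (auto simp: cond_density_def)
  have fRx [measurable]: "fR x \<in> borel_measurable borel" for x
    using measurable_compose[OF measurable_Pair1', OF _ fR_meas, of x] by simp
  have fWv [measurable]: "fW v \<in> borel_measurable borel" for v
    using measurable_compose[OF measurable_Pair1', OF _ fW_meas, of v] by simp
  \<comment> \<open>Given \<open>X\<close>, the running variable carries no information on
    \<open>(\<eta>, \<epsilon>)\<close>, so the same kernel serves for conditioning on
    \<open>(X, R)\<close>.\<close>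
  have KR: "regular_cond_distr M borel ?XR borel ?Z (\<lambda>v. K (fst v))"
    using rcd_cond_indep[OF prob K rR A3_indep] by (simp add: borel_prod)
  have K_prob: "prob_space (K x)" and K_sets [measurable_cong]: "sets (K x) = sets borel"
    and K_space: "space (K x) = UNIV" for x
    using rcd_kernel[OF K, of x] by auto
  have g_comp: "(\<lambda>y. g d (a y) (b y) (c y)) \<in> borel_measurable N"
    if "d \<in> {0, 1}" "a \<in> borel_measurable N" "b \<in> borel_measurable N" "c \<in> borel_measurable N"
    for d a b c and N :: "'n measure"
    using measurable_compose[OF borel_measurable_Pair[OF that(2) borel_measurable_Pair[OF that(3,4)]]
        g_measurable[OF that(1)]] by simp
  have theta_comp: "(\<lambda>y. theta (a y) (b y)) \<in> borel_measurable N"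
    if "a \<in> borel_measurable N" "b \<in> borel_measurable N" for a b and N :: "'n measure"
    using measurable_compose[OF borel_measurable_Pair[OF that] A3_theta_measurable] by simp
  have D_meas [measurable]: "D \<in> borel_measurable M"
  proof -
    have "(\<lambda>\<omega>. if theta (X \<omega>) (R \<omega>) \<ge> eta \<omega> then 1 else 0 :: real) \<in> borel_measurable M"
      using theta_comp[OF rv(1,2)] by measurable
    then show ?thesis using A3_treatment by (simp cong: measurable_cong)
  qed

  text \<open>\<open>tau\<close> itself need not be Borel measurable, being arbitrary outside \<open>XX\<close>.\<close>
  define tau' where "tau' x = (if x \<in> XX then
      (lim (\<lambda>n. mu (x, 1 / Suc n)) - lim (\<lambda>n. mu (x, - 1 / Suc n))) /
      (lim (\<lambda>n. p (x, 1 / Suc n)) - lim (\<lambda>n. p (x, - 1 / Suc n))) else 0)" for x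
  have tau': "tau' x = tau x" if x: "x \<in> XX" for x
  proof -
    \<comment> \<open>One-sided limits that exist can be computed along a sequence, and sequential
      limits preserve measurability.\<close>
    have "lim (\<lambda>n. m (x, 1 / Suc n)) = right_lim (\<lambda>r. m (x, r))"
      if "has_right_lim (\<lambda>r. m (x, r))" for m :: "(real ^ 'd) \<times> real \<Rightarrow> real"
      using filterlim_compose[OF right_lim_tendsto[OF that], of "\<lambda>n. 1 / Suc n" sequentially]
        LIMSEQ_inverse_real_of_nat
      by (intro limI) (auto simp: filterlim_at inverse_eq_divide)
    moreover have "lim (\<lambda>n. m (x, - 1 / Suc n)) = left_lim (\<lambda>r. m (x, r))"
      if "has_left_lim (\<lambda>r. m (x, r))" for m :: "(real ^ 'd) \<times> real \<Rightarrow> real"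
      using filterlim_compose[OF left_lim_tendsto[OF that], of "\<lambda>n. - 1 / Suc n" sequentially]
        tendsto_minus[OF LIMSEQ_inverse_real_of_nat]
      by (intro limI) (auto simp: filterlim_at inverse_eq_divide)
    ultimately show ?thesis
      using x p_limits[OF x] mu_limits[OF x] by (simp add: tau'_def tau)
  qed
  have tau'_meas [measurable]: "tau' \<in> borel_measurable borel"
  proof -
    have m: "(\<lambda>x. m (x, r)) \<in> borel_measurable borel"
      if "m \<in> borel_measurable borel" for m :: "(real ^ 'd) \<times> real \<Rightarrow> real" and r
      by (rule measurable_compose[OF borel_measurable_Pair that]) auto
    have "p \<in> borel_measurable borel" "mu \<in> borel_measurable borel"
      using p mu by (auto simp: cond_mean_def)
    note [measurable] = this[THEN m] XX(1)
    show ?thesis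
      unfolding tau'_def
      by (intro measurable_If borel_measurable_divide borel_measurable_diff borel_measurable_lim_metric) auto
  qed

  \<comment> \<open>Here \<open>v\<close> stands for \<open>(X, R)\<close> and \<open>z\<close> for
    \<open>(\<eta>, \<epsilon>)\<close>. With the treatment rule inserted, the term with
    \<open>tau'\<close> survives only in the untreated branch.\<close>
  let ?W = "\<lambda>(v, z). if fst z \<le> theta (fst v) (snd v) then g 1 (snd v) (fst v) (snd z)
    else g 0 (snd v) (fst v) (snd z) + tau' (fst v)"
  have W_meas: "?W \<in> borel_measurable (borel \<Otimes>\<^sub>M borel)"
  proof -
    have [measurable]: "(\<lambda>y. g d (snd (fst y)) (fst (fst y)) (snd (snd y))) \<in> borel_measurable (borel \<Otimes>\<^sub>M borel)"
      if "d \<in> {0, 1}" for d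
      using that by (rule g_comp) measurable
    have [measurable]: "(\<lambda>y. theta (fst (fst y)) (snd (fst y))) \<in> borel_measurable (borel \<Otimes>\<^sub>M borel)"
      by (rule theta_comp) measurable
    show ?thesis unfolding case_prod_beta by measurable
  qed
  have rW': "regular_cond_distr M borel ?XR borel W (\<lambda>v. distr (K (fst v)) borel (\<lambda>z. ?W (v, z)))"
  proof (rule rcd_cong[OF rcd_distr[OF prob KR W_meas]])
    fix \<omega> assume "\<omega> \<in> space M"
    then show "?W (?XR \<omega>, ?Z \<omega>) = W \<omega>"
      using tau' XX(2) by (simp add: W Y A3_treatment)
  qed

  \<comment> \<open>Properties of almost every covariate value\<close>
  have AE_XX: "AE x in ?PX. x \<in> XX"
    using XX by (subst AE_distr_iff) auto
  \<comment> \<open>\<open>rW\<close> and \<open>rW'\<close> are two versions of one conditional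
    law, so they agree for almost every \<open>(x, r)\<close>. Disintegrating the law of
    \<open>(X, R)\<close> through \<open>fR\<close> confines this to \<open>r\<close> of positive
    density.\<close>
  have AE_law: "AE x in ?PX. AE r in lborel. 0 < fR x r \<longrightarrow>
    distr (K x) borel (\<lambda>z. ?W ((x, r), z)) = density lborel (\<lambda>w. ennreal (fW (x, r) w))"
  proof -
    have "AE v in distr M (borel \<Otimes>\<^sub>M borel) ?XR. distr (K (fst v)) borel (\<lambda>z. ?W (v, z)) = density lborel (\<lambda>w. ennreal (fW v w))"
      unfolding borel_prod by (rule rcd_unique[OF prob rW' rW])
    from rcd_AE_distr[OF prob rR this] show ?thesis
      by (simp add: AE_density)
  qed
  let ?SD = "msupport (distr M borel (\<lambda>\<omega>. (D \<omega>, X \<omega>)))"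
  let ?SE = "msupport (distr M borel (\<lambda>\<omega>. (X \<omega>, eps \<omega>)))"
  \<comment> \<open>A strictly increasing cdf of \<eta> lies strictly between 0 and 1, so whatever
    the threshold, both treatments have positive probability. Hence \<open>A4_factor\<close> becomes
    available for \<open>d = 0\<close> and \<open>d = 1\<close> at the same
    \<open>x\<close>.\<close>
  have AE_SD: "AE x in ?PX. x \<in> XX \<longrightarrow> (0, x) \<in> ?SD \<and> (1, x) \<in> ?SD"
  proof -
    have "AE y in distr M borel (\<lambda>\<omega>. (D \<omega>, X \<omega>)). y \<in> ?SD" by (rule AE_in_msupport) simp
    then have "AE \<omega> in M. (D \<omega>, X \<omega>) \<in> ?SD" by (rule AE_distrD[rotated]) (simp add: borel_measurable_Pair)
    then have "AE \<omega> in M. (if fst (?Z \<omega>) \<le> theta (fst (?XR \<omega>)) (snd (?XR \<omega>)) then 1 else 0, fst (?XR \<omega>)) \<in> ?SD"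
      using AE_space by eventually_elim (simp add: A3_treatment)
    then have "AE v in distr M borel ?XR. AE z in K (fst v).
        (\<lambda>(v, z). (if fst z \<le> theta (fst v) (snd v) then 1 else 0, fst v) \<in> ?SD) (v, z)"
    proof (intro rcd_AE[OF prob KR])
      have [measurable]: "(\<lambda>y. theta (fst (fst y)) (snd (fst y))) \<in> borel_measurable (borel \<Otimes>\<^sub>M borel)"
        by (rule theta_comp) measurable
      have [measurable]: "?SD \<in> sets borel" by (intro borel_closed closed_msupport)
      have "(\<lambda>y :: ((real ^ 'd) \<times> real) \<times> (real \<times> (real ^ 'e)).
          (if fst (snd y) \<le> theta (fst (fst y)) (snd (fst y)) then 1 else 0 :: real, fst (fst y)))
          \<in> borel_measurable (borel \<Otimes>\<^sub>M borel)"
        by (rule borel_measurable_Pair) measurable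
      then show "Measurable.pred (borel \<Otimes>\<^sub>M borel)
          (\<lambda>(v, z). (if fst z \<le> theta (fst v) (snd v) then 1 else 0, fst v) \<in> ?SD)"
        unfolding case_prod_beta by measurable
    qed simp
    then have "AE v in distr M (borel \<Otimes>\<^sub>M borel) ?XR. AE z in K (fst v).
        (if fst z \<le> theta (fst v) (snd v) then 1 else 0, fst v) \<in> ?SD"
      unfolding borel_prod by simp
    from rcd_AE_distr[OF prob rR this] show ?thesis
    proof eventually_elim
      fix x assume ae: "AE r in density lborel (\<lambda>r. ennreal (fR x r)). AE z in K (fst (x, r)).
        (if fst z \<le> theta (fst (x, r)) (snd (x, r)) then 1 else 0, fst (x, r)) \<in> ?SD"
      interpret R: prob_space "density lborel (\<lambda>r. ennreal (fR x r))"
        using rcd_kernel(1)[OF rR, of x] by simp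
      interpret Kx: prob_space "K x" by (rule K_prob)
      \<comment> \<open>A probability measure is not null, so the almost-everywhere statement
        supplies an actual \<open>r\<close>; one suffices.\<close>
      have "ae_filter (density lborel (\<lambda>r. ennreal (fR x r))) \<noteq> bot"
        using R.AE_False by (simp add: trivial_limit_def)
      from eventually_happens'[OF this ae, unfolded fst_conv snd_conv]
      obtain r where r: "AE z in K x. (if fst z \<le> theta x r then 1 else 0, x) \<in> ?SD" ..
      show "x \<in> XX \<longrightarrow> (0, x) \<in> ?SD \<and> (1, x) \<in> ?SD"
      proof
        assume x: "x \<in> XX"
        have m: "fst \<in> borel_measurable (K x)" by measurable
        interpret F: real_distribution "distr (K x) borel fst"
          by (rule Kx.real_distribution_distr) (rule m)
        let ?F = "cdf (distr (K x) borel fst)"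
        have F: "?F t = measure (K x) {z\<in>space (K x). fst z \<le> t}" for t
          using m by (auto simp: cdf_def measure_distr intro!: arg_cong[where f="measure (K x)"])
        \<comment> \<open>Comparison with one smaller and one larger argument makes the trivial
          bounds strict at \<open>theta x r\<close>.\<close>
        have "0 \<le> ?F (theta x r - 1)" "?F (theta x r + 1) \<le> 1"
          by (auto simp: F)
        then have F01: "0 < ?F (theta x r)" "?F (theta x r) < 1"
          using strict_monoD[OF A3_eta_cdf[OF x], of "theta x r - 1" "theta x r"]
            strict_monoD[OF A3_eta_cdf[OF x], of "theta x r" "theta x r + 1"] by auto
        show "(0, x) \<in> ?SD \<and> (1, x) \<in> ?SD"
        proof (intro conjI; rule ccontr)
          assume "(0, x) \<notin> ?SD"
          then have "AE z in K x. fst z \<le> theta x r"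
            using r by (auto elim!: eventually_mono split: if_splits)
          then have "?F (theta x r) = 1"
            unfolding F using m by (subst Kx.prob_Collect_eq_1) auto
          with F01 show False by simp
        next
          assume "(1, x) \<notin> ?SD"
          then have "AE z in K x. \<not> fst z \<le> theta x r"
            using r by (auto elim!: eventually_mono split: if_splits)
          then have "?F (theta x r) = 0"
            unfolding F using m by (subst Kx.prob_Collect_eq_0) auto
          with F01 show False by simp
        qed
      qed
    qed
  qed
  have AE_SE: "AE x in ?PX. AE z in K x. (x, snd z) \<in> ?SE"
  proof -
    have "AE y in distr M borel (\<lambda>\<omega>. (X \<omega>, eps \<omega>)). y \<in> ?SE" by (rule AE_in_msupport) simp
    then have "AE \<omega> in M. (X \<omega>, eps \<omega>) \<in> ?SE" by (rule AE_distrD[rotated]) (simp add: borel_measurable_Pair)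
    then have "AE \<omega> in M. (\<lambda>(v, z). (v, snd z) \<in> ?SE) (X \<omega>, ?Z \<omega>)" by simp
    then have "AE x in ?PX. AE z in K x. (\<lambda>(v, z). (v, snd z) \<in> ?SE) (x, z)"
    proof (rule rcd_AE[OF prob K, rotated])
      have [measurable]: "?SE \<in> sets borel" by (intro borel_closed closed_msupport)
      have "(\<lambda>y :: (real ^ 'd) \<times> (real \<times> (real ^ 'e)). (fst y, snd (snd y))) \<in> borel_measurable (borel \<Otimes>\<^sub>M borel)"
        by (rule borel_measurable_Pair) measurable
      then show "Measurable.pred (borel \<Otimes>\<^sub>M borel) (\<lambda>(v, z). (v, snd z) \<in> ?SE)"
        unfolding case_prod_beta by measurable
    qed
    then show ?thesis by simp
  qed

  \<comment> \<open>The equivalence at a fixed covariate value\<close>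
  have main: "AE x in ?PX. \<P>(z in K x. g 1 0 x (snd z) - g 0 0 x (snd z) = tau x) = 1 \<longleftrightarrow>
    (AE w in lborel. right_lim (\<lambda>r. fW (x, r) w) = left_lim (\<lambda>r. fW (x, r) w))"
    using AE_XX AE_law AE_SD AE_SE
  proof eventually_elim
    fix x assume x: "x \<in> XX"
      and law: "AE r in lborel. 0 < fR x r \<longrightarrow>
        distr (K x) borel (\<lambda>z. ?W ((x, r), z)) = density lborel (\<lambda>w. ennreal (fW (x, r) w))"
      and "x \<in> XX \<longrightarrow> (0, x) \<in> ?SD \<and> (1, x) \<in> ?SD"
      and SE: "AE z in K x. (x, snd z) \<in> ?SE"
    then have SD: "(0, x) \<in> ?SD" "(1, x) \<in> ?SD" by auto
    interpret Kx: prob_space "K x" by (rule K_prob)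
    have fst_meas [measurable]: "fst \<in> borel_measurable (K x)"
      and snd_meas [measurable]: "snd \<in> borel_measurable (K x)"
      by (auto simp: K_sets cong: measurable_cong_sets intro!: borel_measurable_continuous_onI continuous_intros)
    have g_meas [measurable]: "(\<lambda>z. g d r x (snd z)) \<in> borel_measurable (K x)" if "d \<in> {0, 1}" for d r
      using that by (intro g_comp) auto
    have g_cont: "isCont (\<lambda>r. g d r x e) 0" if "d \<in> {0, 1}" for d e
    proof -
      obtain \<delta> where "0 < \<delta>" "continuous_on {-\<delta><..<\<delta>} (\<lambda>r. g d r x e)"
        using A4_continuous[OF \<open>d \<in> {0, 1}\<close> x, of e] by auto
      then show ?thesis by (auto simp: continuous_on_eq_continuous_at)
    qed
    interpret F: real_distribution "distr (K x) borel fst"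
      by (rule Kx.real_distribution_distr) simp
    have no_atom: "AE z in K x. fst z \<noteq> c" if "isCont (cdf (distr (K x) borel fst)) c" for c
    proof -
      have "{c} \<in> null_sets (distr (K x) borel fst)"
        using that by (simp add: F.isCont_cdf F.emeasure_eq_measure null_sets_def)
      then have "AE y in distr (K x) borel fst. y \<notin> {c}" by (rule AE_not_in)
      then show ?thesis by (subst (asm) AE_distr_iff) auto
    qed
    let ?th1 = "left_lim (theta x)" and ?th2 = "right_lim (theta x)"
    \<comment> \<open>The two possible values of \<open>W\<close> at the cutoff, treated and
      untreated; the null hypothesis at \<open>x\<close> says that they agree almost surely.\<close>
    let ?A = "\<lambda>z. g 1 0 x (snd z)" and ?B = "\<lambda>z. g 0 0 x (snd z) + tau' x"
    \<comment> \<open>The identity of laws is known only for almost every \<open>r\<close> of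
      positive density, so each one-sided limit is taken along a sequence of such
      \<open>r\<close>.\<close>
    obtain s1 where s1: "filterlim s1 (at_left 0) sequentially"
      "\<And>n::nat. distr (K x) borel (\<lambda>z. ?W ((x, s1 n), z)) = density lborel (\<lambda>w. ennreal (fW (x, s1 n) w))"
      using AE_sequence_at_left[OF law A1_positive[OF x]] by blast
    obtain s2 where s2: "filterlim s2 (at_right 0) sequentially"
      "\<And>n::nat. distr (K x) borel (\<lambda>z. ?W ((x, s2 n), z)) = density lborel (\<lambda>w. ennreal (fW (x, s2 n) w))"
      using AE_sequence_at_right[OF law A1_positive[OF x]] by blast
    have "\<exists>h\<in>borel_measurable borel. (AE w in lborel. h w = left_lim (\<lambda>r. fW (x, r) w)) \<and> (AE w in lborel. 0 \<le> h w) \<and>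
      distr (K x) borel (\<lambda>z. if fst z \<le> ?th1 then ?A z else ?B z) = density lborel (\<lambda>w. ennreal (h w))"
    proof (rule cutoff_limit_law[where F="at_left 0" and s=s1 and th="theta x" and f="\<lambda>r. fW (x, r)"
        and ?G1.0="\<lambda>r z. g 1 r x (snd z)" and ?G0.0="\<lambda>r z. g 0 r x (snd z) + tau' x"])
      show "at_left (0 :: real) \<le> at 0" by (intro at_le) simp
      show "(theta x \<longlongrightarrow> ?th1) (at_left 0)"
        by (rule left_lim_tendsto[OF A3_theta_continuous(3)[OF x]])
      show "AE w in lborel. ((\<lambda>r. fW (x, r) w) \<longlongrightarrow> left_lim (\<lambda>r. fW (x, r) w)) (at_left 0)"
        using fW_limits(1)[OF x] by eventually_elim (rule left_lim_tendsto)
      show "distr (K x) borel (\<lambda>z. if fst z \<le> theta x (s1 n) then g 1 (s1 n) x (snd z) else g 0 (s1 n) x (snd z) + tau' x) =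
          density lborel (\<lambda>w. ennreal (fW (x, s1 n) w))" for n
        using s1(2)[of n] unfolding prod.case fst_conv snd_conv .
      show "isCont (\<lambda>r. g 1 r x (snd z)) 0" "isCont (\<lambda>r. g 0 r x (snd z) + tau' x) 0" for z
        by (intro continuous_intros g_cont; simp)+
      show "(\<lambda>z. g 1 r x (snd z)) \<in> borel_measurable (K x)"
        "(\<lambda>z. g 0 r x (snd z) + tau' x) \<in> borel_measurable (K x)" for r
        by (intro borel_measurable_add borel_measurable_const g_meas; simp)+
    qed (rule K_prob fst_meas no_atom[OF A3_eta_no_atom(1)[OF x]] x fWv fW_nonneg fW_limits_densities(1) s1(1))+
    then obtain h1 where h1: "h1 \<in> borel_measurable borel"
      "AE w in lborel. h1 w = left_lim (\<lambda>r. fW (x, r) w)" "AE w in lborel. 0 \<le> h1 w"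
      "distr (K x) borel (\<lambda>z. if fst z \<le> ?th1 then ?A z else ?B z) = density lborel (\<lambda>w. ennreal (h1 w))"
      by blast
    have "\<exists>h\<in>borel_measurable borel. (AE w in lborel. h w = right_lim (\<lambda>r. fW (x, r) w)) \<and> (AE w in lborel. 0 \<le> h w) \<and>
      distr (K x) borel (\<lambda>z. if fst z \<le> ?th2 then ?A z else ?B z) = density lborel (\<lambda>w. ennreal (h w))"
    proof (rule cutoff_limit_law[where F="at_right 0" and s=s2 and th="theta x" and f="\<lambda>r. fW (x, r)"
        and ?G1.0="\<lambda>r z. g 1 r x (snd z)" and ?G0.0="\<lambda>r z. g 0 r x (snd z) + tau' x"])
      show "at_right (0 :: real) \<le> at 0" by (intro at_le) simp
      show "(theta x \<longlongrightarrow> ?th2) (at_right 0)"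
        by (rule right_lim_tendsto[OF A3_theta_continuous(4)[OF x]])
      show "AE w in lborel. ((\<lambda>r. fW (x, r) w) \<longlongrightarrow> right_lim (\<lambda>r. fW (x, r) w)) (at_right 0)"
        using fW_limits(2)[OF x] by eventually_elim (rule right_lim_tendsto)
      show "distr (K x) borel (\<lambda>z. if fst z \<le> theta x (s2 n) then g 1 (s2 n) x (snd z) else g 0 (s2 n) x (snd z) + tau' x) =
          density lborel (\<lambda>w. ennreal (fW (x, s2 n) w))" for n
        using s2(2)[of n] unfolding prod.case fst_conv snd_conv .
      show "isCont (\<lambda>r. g 1 r x (snd z)) 0" "isCont (\<lambda>r. g 0 r x (snd z) + tau' x) 0" for z
        by (intro continuous_intros g_cont; simp)+
      show "(\<lambda>z. g 1 r x (snd z)) \<in> borel_measurable (K x)"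
        "(\<lambda>z. g 0 r x (snd z) + tau' x) \<in> borel_measurable (K x)" for r
        by (intro borel_measurable_add borel_measurable_const g_meas; simp)+
    qed (rule K_prob fst_meas no_atom[OF A3_eta_no_atom(2)[OF x]] x fWv fW_nonneg fW_limits_densities(2) s2(1))+
    then obtain h2 where h2: "h2 \<in> borel_measurable borel"
      "AE w in lborel. h2 w = right_lim (\<lambda>r. fW (x, r) w)" "AE w in lborel. 0 \<le> h2 w"
      "distr (K x) borel (\<lambda>z. if fst z \<le> ?th2 then ?A z else ?B z) = density lborel (\<lambda>w. ennreal (h2 w))"
      by blast
    \<comment> \<open>The shift \<open>t\<close> lets one argument serve both variables: it is zero
      for \<open>?A\<close> and \<open>tau' x\<close> for \<open>?B\<close>. By \<open>A5\<close>,
      almost every value lies in the support of the law restricted to the compliers.\<close>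
    have supp: "AE z in K x. \<forall>U. open U \<and> g d 0 x (snd z) + t \<in> U \<longrightarrow>
        0 < emeasure (K x) {y\<in>space (K x). fst y \<in> {?th1<..?th2} \<and> g d 0 x (snd y) + t \<in> U}"
      if d: "d \<in> {0, 1}" for d t
    proof -
      let ?f = "\<lambda>z. g d 0 x (snd z)" and ?C = "{z. fst z \<in> compliers theta x}"
      note [measurable] = g_meas[OF d]
      have C [measurable]: "?C \<in> sets (K x)"
        using measurable_sets[OF fst_meas, of "compliers theta x"]
        by (simp add: compliers_def K_space vimage_def)
      have "AE y in distr (K x) borel ?f. y \<in> msupport (distr (K x) borel ?f)"
        by (rule AE_in_msupport) simp
      then have "AE z in K x. ?f z \<in> msupport (distr (K x) borel ?f)"
        by (rule AE_distrD[rotated]) measurable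
      then show ?thesis
      proof eventually_elim
        fix z assume z: "?f z \<in> msupport (distr (K x) borel ?f)"
        show "\<forall>U. open U \<and> ?f z + t \<in> U \<longrightarrow>
          0 < emeasure (K x) {y\<in>space (K x). fst y \<in> {?th1<..?th2} \<and> ?f y + t \<in> U}"
        proof (intro allI impI, elim conjE)
          fix U assume U: "open U" "?f z + t \<in> U"
          let ?V = "(\<lambda>y. y + t) -` U"
          have V: "open ?V" using U(1) by (intro open_vimage continuous_intros)
          then have Vm: "?f -` ?V \<inter> space (K x) \<in> sets (K x)"
            by (intro measurable_sets[OF g_meas[OF d]]) auto
          have "0 < emeasure (distr (uniform_measure (K x) ?C) borel ?f) ?V"
            using z V U(2) unfolding A5[OF d x, symmetric] by (auto simp: msupport_def)
          also have "\<dots> = emeasure (uniform_measure (K x) ?C) (?f -` ?V \<inter> space (K x))"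
            using V g_meas[OF d] by (subst emeasure_distr) auto
          also have "\<dots> = emeasure (K x) (?C \<inter> (?f -` ?V \<inter> space (K x))) / emeasure (K x) ?C"
            using C Vm by (rule emeasure_uniform_measure)
          \<comment> \<open>A positive quotient has a positive numerator, which removes the
            normalization by the mass of the compliers.\<close>
          finally have "0 < emeasure (K x) (?C \<inter> (?f -` ?V \<inter> space (K x)))"
            by (auto simp: zero_less_iff_neq_zero)
          also have "?C \<inter> (?f -` ?V \<inter> space (K x)) =
              {y\<in>space (K x). fst y \<in> {?th1<..?th2} \<and> ?f y + t \<in> U}"
            by (auto simp: compliers_def)
          finally show "0 < emeasure (K x) {y\<in>space (K x). fst y \<in> {?th1<..?th2} \<and> ?f y + t \<in> U}" .
        qed
      qed
    qed
    have "\<P>(z in K x. g 1 0 x (snd z) - g 0 0 x (snd z) = tau x) = 1 \<longleftrightarrow> (AE z in K x. ?A z = ?B z)"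
    proof (subst Kx.prob_Collect_eq_1)
      have "(\<lambda>z. g 1 0 x (snd z) - g 0 0 x (snd z)) \<in> borel_measurable (K x)"
        by (intro borel_measurable_diff g_meas; simp)
      then show "{z \<in> space (K x). g 1 0 x (snd z) - g 0 0 x (snd z) = tau x} \<in> sets (K x)"
        by measurable
      show "(AE z in K x. g 1 0 x (snd z) - g 0 0 x (snd z) = tau x) \<longleftrightarrow> (AE z in K x. ?A z = ?B z)"
        unfolding tau'[OF x] diff_eq_eq by (simp add: add.commute)
    qed
    also have "\<dots> \<longleftrightarrow> (AE w in lborel. h2 w = h1 w)"
    proof (rule switching_law_eq_iff[OF K_prob fst_meas _ _ _ h1(1) h2(1) h1(4) h2(4) h1(3) h2(3)])
      \<comment> \<open>The common scalar is \<open>nu x (snd z)\<close>; adding the constant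
        \<open>tau' x\<close> preserves strict monotonicity of \<open>gt 0 x\<close>.\<close>
      show "AE z in K x. ?A z = gt 1 x (nu x (snd z)) \<and> ?B z = gt 0 x (nu x (snd z)) + tau' x"
        using SE by eventually_elim (use A4_factor SD in auto)
      show "strict_mono (gt 1 x)" by (rule A4_gt_increasing[OF SD(2)])
      show "strict_mono (\<lambda>v. gt 0 x v + tau' x)"
        using A4_gt_increasing[OF SD(1)] by (simp add: strict_mono_def)
      show "?th1 \<le> ?th2" using A3_theta_jump[OF x] by simp
      show "?A \<in> borel_measurable (K x)" "?B \<in> borel_measurable (K x)"
        by (intro borel_measurable_add borel_measurable_const g_meas; simp)+
      show "AE z in K x. \<forall>U. open U \<and> ?A z \<in> U \<longrightarrow>
          0 < emeasure (K x) {y\<in>space (K x). fst y \<in> {?th1<..?th2} \<and> ?A y \<in> U}"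
        using supp[of 1 0, OF insertI2[OF singletonI]] unfolding add_0_right .
      show "AE z in K x. \<forall>U. open U \<and> ?B z \<in> U \<longrightarrow>
          0 < emeasure (K x) {y\<in>space (K x). fst y \<in> {?th1<..?th2} \<and> ?B y \<in> U}"
        by (rule supp) simp
    qed
    also have "\<dots> \<longleftrightarrow> (AE w in lborel. right_lim (\<lambda>r. fW (x, r) w) = left_lim (\<lambda>r. fW (x, r) w))"
    proof (rule eventually_subst)
      show "AE w in lborel. (h2 w = h1 w) = (right_lim (\<lambda>r. fW (x, r) w) = left_lim (\<lambda>r. fW (x, r) w))"
        using h1(2) h2(2) by eventually_elim simp
    qed
    finally show "\<P>(z in K x. g 1 0 x (snd z) - g 0 0 x (snd z) = tau x) = 1 \<longleftrightarrow>
      (AE w in lborel. right_lim (\<lambda>r. fW (x, r) w) = left_lim (\<lambda>r. fW (x, r) w))" .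
  qed
  then have iff: "homogeneous_effect_at_cutoff ?PX K g tau \<longleftrightarrow>
    (AE x in ?PX. AE w in lborel. right_lim (\<lambda>r. fW (x, r) w) = left_lim (\<lambda>r. fW (x, r) w))"
    unfolding homogeneous_effect_at_cutoff_def by (rule eventually_subst)

  \<comment> \<open>From almost every to every outcome value\<close>
  show ?thesis
  proof (rule conjI[OF iff], rule impI)
    assume cont: "\<forall>x\<in>XX. continuous_on UNIV (\<lambda>w. right_lim (\<lambda>r. fW (x, r) w)) \<and>
      continuous_on UNIV (\<lambda>w. left_lim (\<lambda>r. fW (x, r) w))"
    have "AE x in ?PX. (AE w in lborel. right_lim (\<lambda>r. fW (x, r) w) = left_lim (\<lambda>r. fW (x, r) w)) \<longleftrightarrow>
      (\<forall>w. right_lim (\<lambda>r. fW (x, r) w) = left_lim (\<lambda>r. fW (x, r) w))"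
      using AE_XX
    proof eventually_elim
      fix x assume "x \<in> XX"
      with cont have "continuous_on UNIV (\<lambda>w. right_lim (\<lambda>r. fW (x, r) w))"
        "continuous_on UNIV (\<lambda>w. left_lim (\<lambda>r. fW (x, r) w))"
        by blast+
      from AE_lborel_continuous_eq[OF _ this]
      show "(AE w in lborel. right_lim (\<lambda>r. fW (x, r) w) = left_lim (\<lambda>r. fW (x, r) w)) \<longleftrightarrow>
        (\<forall>w. right_lim (\<lambda>r. fW (x, r) w) = left_lim (\<lambda>r. fW (x, r) w))"
        by (intro iffI allI) (assumption, rule AE_I2, erule spec)
    qed
    then show "homogeneous_effect_at_cutoff ?PX K g tau \<longleftrightarrow>
      (AE x in ?PX. \<forall>w. right_lim (\<lambda>r. fW (x, r) w) = left_lim (\<lambda>r. fW (x, r) w))"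
      unfolding iff by (rule eventually_subst)
  qed
qed

end
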